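(* Let $k$ and $d$ be positive integers. Suppose there exists an algorithm for $[\mathsf{Static}]\mathsf{kD\;LWS}_{n,N,d}$ with running time $O(N^{2-\varepsilon}\cdot n^{k-1})$ for some $\varepsilon>0$. Then there exists an algorithm for $\mathsf{kD\;LWS}_{n,d}$ with running time $O(n^{k+1-\delta})$ for some $\delta>0$.
   Context: Generalized inner product: $\langle x_1,\ldots,x_m\rangle=\sum_{s=1}^d\prod_{t=1}^m x_t[s]$. A tensor $w:[n]^{k+1}\to\mathbb{R}$ has rank $d$ if there are vectors $x_{t,i}\in\mathbb{R}^d$ with $w[i_1,\ldots,i_{k+1}]=\langle x_{1,i_1},\ldots,x_{k+1,i_{k+1}}\rangle$. $\mathsf{kD\;LWS}_{n,d}$: given tensors $w_1,\ldots,w_k:[n]^{k+1}\to\{-W,\ldots,W,\infty\}$, each of rank $d$ and given by such vectors, define $T:[n]^k\to\mathbb{Z}\cup\{\infty\}$ by $T[1,\ldots,1]=0$ and otherwise $T[j_1,\ldots,j_k]=\min_{1\le\ell\le k}\min_{1\le i_\ell<j_\ell}\bigl(T[j_1,\ldots,j_{\ell-1},i_\ell,j_{\ell+1},\ldots,j_k]+w_\ell[j_1,\ldots,j_k,i_\ell]\bigr)$; output $T[n,\ldots,n]$. For integers $\alpha\le\beta$ let $D_{\alpha,\beta}=\{(i_1,\ldots,i_k)\in[n]^k:\alpha\le i_1+\cdots+i_k<\beta\}$. $[\mathsf{Static}]\mathsf{kD\;LWS}_{n,N,d}$: given such $w_1,\ldots,w_k$ of rank $d$, integers $a,N$, and the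 correctly computed values $T[i_1,\ldots,i_k]$ for all $(i_1,\ldots,i_k)\in D_{a,a+N}$, output for every $(j_1,\ldots,j_k)\in D_{a+N,a+2N}$ the value $T'[j_1,\ldots,j_k]=\min_{1\le\ell\le k}\min_{a-J_\ell\le i_\ell<a+N-J_\ell}\bigl(T[j_1,\ldots,j_{\ell-1},i_\ell,j_{\ell+1},\ldots,j_k]+w_\ell[j_1,\ldots,j_k,i_\ell]\bigr)$, where $J_\ell=\sum_{t\ne\ell}j_t$. Word-RAM model with word size $\Theta(\log n)$. *)

theory Defs
  imports Complex_Main "HOL-Library.Extended_Real"
begin

section \<open>Tensors of low rank\<close>

text \<open>Index tuples are lists with entries in \<open>{1..n}\<close>; list positions are counted from 0. A vector of
  length \<open>d\<close> is a function on coordinates of which only the values at \<open>s < d\<close> matter.\<close>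

definition cube :: "nat \<Rightarrow> nat \<Rightarrow> nat list set" where
  "cube n m = {is. length is = m \<and> set is \<subseteq> {1..n}}"

definition gen_inner :: "nat \<Rightarrow> (nat \<Rightarrow> real) list \<Rightarrow> real" where
  "gen_inner d xs = (\<Sum>s<d. \<Prod>x\<leftarrow>xs. x s)"

text \<open>The order-\<open>m\<close> tensor \<open>w\<close> over \<open>[n]\<close> has rank \<open>d\<close>, witnessed by the vectors \<open>x t i\<close>
  (\<open>t < m\<close>, \<open>i \<in> [n]\<close>). Tensor entries are extended reals because \<open>\<infinity>\<close> is a permitted weight in
  general; this condition forces the entries to be finite.\<close>

definition rank_by :: "nat \<Rightarrow> nat \<Rightarrow> nat \<Rightarrow> (nat list \<Rightarrow> ereal) \<Rightarrow> (nat \<Rightarrow> nat \<Rightarrow> nat \<Rightarrow> real) \<Rightarrow> bool" where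
  "rank_by n m d w x \<longleftrightarrow>
     (\<forall>is\<in>cube n m. w is = ereal (gen_inner d (map (\<lambda>t. x t (is ! t)) [0..<m])))"


section \<open>kD LWS and its static version\<close>

text \<open>\<open>w l\<close> is the tensor attached to direction \<open>l < k\<close>, where \<open>k\<close> is the length of the index
  tuple. All index sets are finite, so the infima are minima; the minimum of the empty set is \<open>\<infinity>\<close>.\<close>

function lws_T :: "(nat \<Rightarrow> nat list \<Rightarrow> ereal) \<Rightarrow> nat list \<Rightarrow> ereal" where
  "lws_T w js =
     (if js = replicate (length js) 1 then 0
      else (INF l\<in>{..<length js}. INF i\<in>{1..<js ! l}. lws_T w (js[l := i]) + w l (js @ [i])))"
  by pat_completeness auto
termination
proof (relation "measure (\<lambda>(w, js). sum_list js)", goal_cases)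
  case (2 w js l i)
  then have "l < length js" "i < js ! l" by auto
  moreover have "js ! l \<le> sum_list js"
    using \<open>l < length js\<close> by (simp add: elem_le_sum_list)
  ultimately show ?case by (simp add: sum_list_update)
qed simp

declare lws_T.simps [simp del]

definition strip :: "nat \<Rightarrow> nat \<Rightarrow> int \<Rightarrow> int \<Rightarrow> nat list set" where
  "strip n k \<alpha> \<beta> = {is \<in> cube n k. \<alpha> \<le> int (sum_list is) \<and> int (sum_list is) < \<beta>}"

definition static_T ::
  "nat \<Rightarrow> (nat \<Rightarrow> nat list \<Rightarrow> ereal) \<Rightarrow> int \<Rightarrow> nat \<Rightarrow> nat list \<Rightarrow> ereal" where
  "static_T n w a N js =
     (INF l\<in>{..<length js}.
        let J = (\<Sum>t\<in>{..<length js} - {l}. int (js ! t)) in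
        INF i\<in>{i \<in> {1..n}. a - J \<le> int i \<and> int i < a + int N - J}.
          lws_T w (js[l := i]) + w l (js @ [i]))"


section \<open>Word RAM\<close>

text \<open>Words are signed integers of \<open>w + 1\<close> bits. The machine has a random-access read-only input
  and a random-access work memory that is initially 0. Instead of wrapping around, a computation
  that produces a value outside the word range is stuck, so an algorithm has to avoid overflow;
  up to a constant factor in the word size and in the running time this is no restriction.
  Control flow is structured, which costs a constant factor compared to jumps. Since a program is
  fixed, its expressions have constant size, and every assignment or test counts as one step.\<close>

definition fits :: "nat \<Rightarrow> int \<Rightarrow> bool" where
  "fits w z \<longleftrightarrow> - (2 ^ w) \<le> z \<and> z < 2 ^ w"

definition word_size :: "nat \<Rightarrow> nat \<Rightarrow> nat" where
  "word_size c n = c * nat \<lceil>log 2 (real n + 1)\<rceil>"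

datatype binop = Add | Sub | Mul | Div | Mod | And | Or | Xor | Shl | Shr | Less | Eq

fun apply_op :: "binop \<Rightarrow> int \<Rightarrow> int \<Rightarrow> int" where
  "apply_op Add x y = x + y"
| "apply_op Sub x y = x - y"
| "apply_op Mul x y = x * y"
| "apply_op Div x y = x div y"
| "apply_op Mod x y = x mod y"
| "apply_op And x y = Bit_Operations.and x y"
| "apply_op Or x y = Bit_Operations.or x y"
| "apply_op Xor x y = Bit_Operations.xor x y"
| "apply_op Shl x y = push_bit (nat y) x"
| "apply_op Shr x y = drop_bit (nat y) x"
| "apply_op Less x y = of_bool (x < y)"
| "apply_op Eq x y = of_bool (x = y)"

datatype expr = Const int | Load expr | Input expr | Op binop expr expr

datatype prog =
    Skip
  | Store expr expr
  | Seq prog prog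
  | Cond expr prog prog
  | While expr prog

type_synonym memory = "int \<Rightarrow> int"

definition check :: "nat \<Rightarrow> int \<Rightarrow> int option" where
  "check w z = (if fits w z then Some z else None)"

primrec eval_expr :: "nat \<Rightarrow> memory \<Rightarrow> memory \<Rightarrow> expr \<Rightarrow> int option" where
  "eval_expr w inp m (Const z) = check w z"
| "eval_expr w inp m (Load e) = Option.bind (eval_expr w inp m e) (\<lambda>p. check w (m p))"
| "eval_expr w inp m (Input e) = Option.bind (eval_expr w inp m e) (\<lambda>p. check w (inp p))"
| "eval_expr w inp m (Op f e1 e2) =
     Option.bind (eval_expr w inp m e1) (\<lambda>x.
     Option.bind (eval_expr w inp m e2) (\<lambda>y. check w (apply_op f x y)))"

text \<open>\<open>exec w inp P m t m'\<close>: with word size \<open>w\<close> and input \<open>inp\<close>, program \<open>P\<close> started in work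
  memory \<open>m\<close> halts after \<open>t\<close> steps in work memory \<open>m'\<close>. \<open>Store p e\<close> writes the value of \<open>e\<close> to the
  address that \<open>p\<close> evaluates to; tests succeed on nonzero values.\<close>

inductive exec :: "nat \<Rightarrow> memory \<Rightarrow> prog \<Rightarrow> memory \<Rightarrow> nat \<Rightarrow> memory \<Rightarrow> bool" for w inp where
  Skip: "exec w inp Skip m 1 m"
| Store: "eval_expr w inp m p = Some a \<Longrightarrow> eval_expr w inp m e = Some v \<Longrightarrow>
    exec w inp (Store p e) m 1 (m(a := v))"
| Seq: "exec w inp P m t m' \<Longrightarrow> exec w inp Q m' t' m'' \<Longrightarrow>
    exec w inp (Seq P Q) m (t + t') m''"
| Cond_true: "eval_expr w inp m e = Some v \<Longrightarrow> v \<noteq> 0 \<Longrightarrow> exec w inp P m t m' \<Longrightarrow>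
    exec w inp (Cond e P Q) m (t + 1) m'"
| Cond_false: "eval_expr w inp m e = Some 0 \<Longrightarrow> exec w inp Q m t m' \<Longrightarrow>
    exec w inp (Cond e P Q) m (t + 1) m'"
| While_true: "eval_expr w inp m e = Some v \<Longrightarrow> v \<noteq> 0 \<Longrightarrow> exec w inp P m t m' \<Longrightarrow>
    exec w inp (While e P) m' t' m'' \<Longrightarrow> exec w inp (While e P) m (t + t' + 1) m''"
| While_false: "eval_expr w inp m e = Some 0 \<Longrightarrow> exec w inp (While e P) m 1 m"


section \<open>Instances and their encoding\<close>

text \<open>Vector entries are reals; a word RAM can only be given them through some encoding by
  words. We fix an arbitrary encoding with \<open>b\<close> words per entry, decoded by \<open>dec\<close> (for integer
  entries, \<open>b = 1\<close> and \<open>dec [z] = z\<close>; for rationals, \<open>b = 2\<close> and \<open>dec [p, q] = p / q\<close>).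
  The words encoding coordinate \<open>s\<close> of the vector \<open>x\<^sub>t\<^sub>,\<^sub>i\<close> of the tensor \<open>w l\<close> are
  \<open>e l t i s 0, \<dots>, e l t i s (b - 1)\<close>. The weight bound \<open>W\<close> and the encoding words have
  \<open>word_size c n\<close> bits, that is, they are bounded by a polynomial in \<open>n\<close> of fixed degree.\<close>

type_synonym encoding = "nat \<Rightarrow> nat \<Rightarrow> nat \<Rightarrow> nat \<Rightarrow> nat \<Rightarrow> int"

definition lws_instance ::
  "nat \<Rightarrow> nat \<Rightarrow> nat \<Rightarrow> nat \<Rightarrow> (int list \<Rightarrow> real) \<Rightarrow> nat \<Rightarrow> (nat \<Rightarrow> nat list \<Rightarrow> ereal) \<Rightarrow> encoding \<Rightarrow> bool"
where
  "lws_instance k d c b dec n w e \<longleftrightarrow>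
     n \<ge> 1 \<and>
     (\<exists>W. fits (word_size c n) W \<and>
        (\<forall>l<k. \<forall>is\<in>cube n (k + 1).
           w l is = \<infinity> \<or> (\<exists>z\<in>{-W..W}. w l is = ereal (real_of_int z)))) \<and>
     (\<forall>l<k. rank_by n (k + 1) d (w l) (\<lambda>t i s. dec (map (e l t i s) [0..<b]))) \<and>
     (\<forall>l<k. \<forall>t<k + 1. \<forall>i\<in>{1..n}. \<forall>s<d. \<forall>r<b. fits (word_size c n) (e l t i s r))"

text \<open>A value in \<open>\<int> \<union> {\<infinity>}\<close> occupies two words, an infinity flag and the number.\<close>

definition enc_flag :: "ereal \<Rightarrow> int" where
  "enc_flag v = of_bool (v = \<infinity>)"

definition enc_num :: "ereal \<Rightarrow> int" where
  "enc_num v = (if v = \<infinity> then 0 else \<lfloor>real_of_ereal v\<rfloor>)"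

definition stored_at :: "memory \<Rightarrow> nat \<Rightarrow> ereal \<Rightarrow> bool" where
  "stored_at m p v \<longleftrightarrow> m (int p) = enc_flag v \<and> m (int p + 1) = enc_num v"

definition vec_words :: "nat \<Rightarrow> nat \<Rightarrow> nat \<Rightarrow> nat \<Rightarrow> nat" where
  "vec_words k d b n = k * (k + 1) * n * d * b"

definition vectors_at :: "nat \<Rightarrow> nat \<Rightarrow> nat \<Rightarrow> nat \<Rightarrow> encoding \<Rightarrow> memory \<Rightarrow> nat \<Rightarrow> bool" where
  "vectors_at k d b n e m p \<longleftrightarrow>
     (\<forall>l<k. \<forall>t<k + 1. \<forall>i\<in>{1..n}. \<forall>s<d. \<forall>r<b.
        m (int (p + ((((l * (k + 1) + t) * n + (i - 1)) * d + s) * b + r))) = e l t i s r)"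

text \<open>Position of an index tuple in a \<open>k\<close>-dimensional table with side length \<open>n\<close>.\<close>

definition table_index :: "nat \<Rightarrow> nat list \<Rightarrow> nat" where
  "table_index n js = (\<Sum>t<length js. (js ! t - 1) * n ^ t)"

definition lws_input :: "nat \<Rightarrow> nat \<Rightarrow> nat \<Rightarrow> nat \<Rightarrow> encoding \<Rightarrow> memory \<Rightarrow> bool" where
  "lws_input k d b n e inp \<longleftrightarrow>
     inp 0 = int n \<and>
     vectors_at k d b n e inp 1 \<and>
     (\<forall>p. p < 0 \<or> p \<ge> int (1 + vec_words k d b n) \<longrightarrow> inp p = 0)"

text \<open>The known values are given in a table over all of \<open>[n]\<^sup>k\<close> that is 0 outside the known strip.\<close>

definition static_input ::
  "nat \<Rightarrow> nat \<Rightarrow> nat \<Rightarrow> nat \<Rightarrow> (nat \<Rightarrow> nat list \<Rightarrow> ereal) \<Rightarrow> encoding \<Rightarrow> int \<Rightarrow> nat \<Rightarrow> memory \<Rightarrow> bool"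
where
  "static_input k d b n w e a N inp \<longleftrightarrow>
     inp 0 = int n \<and> inp 1 = a \<and> inp 2 = int N \<and>
     vectors_at k d b n e inp 3 \<and>
     (\<forall>js\<in>cube n k.
        stored_at inp (3 + vec_words k d b n + 2 * table_index n js)
          (if js \<in> strip n k a (a + int N) then lws_T w js else 0)) \<and>
     (\<forall>p. p < 0 \<or> p \<ge> int (3 + vec_words k d b n + 2 * n ^ k) \<longrightarrow> inp p = 0)"


section \<open>Algorithms\<close>

text \<open>The running time is at most a constant times \<open>f n\<close>, on a word RAM whose word size is some
  constant multiple of \<open>log n\<close>.\<close>

definition lws_algorithm ::
  "nat \<Rightarrow> nat \<Rightarrow> nat \<Rightarrow> nat \<Rightarrow> (int list \<Rightarrow> real) \<Rightarrow> (nat \<Rightarrow> real) \<Rightarrow> bool" where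
  "lws_algorithm k d c b dec f \<longleftrightarrow>
     (\<exists>P c' C. \<forall>n w e inp.
        lws_instance k d c b dec n w e \<and> lws_input k d b n e inp \<longrightarrow>
        (\<exists>t m. exec (word_size c' n) inp P (\<lambda>_. 0) t m \<and> real t \<le> C * f n \<and>
           stored_at m 0 (lws_T w (replicate k n))))"

text \<open>The diagonals \<open>i\<^sub>1 + \<dots> + i\<^sub>k\<close> range over \<open>{k..k * n}\<close>. The condition on \<open>a\<close> and \<open>N\<close> says
  that \<open>D\<^bsub>a,a+N\<^esub>\<close> starts at an existing diagonal and that some diagonal follows it; \<open>a + 2 * N\<close> may
  exceed the last diagonal.\<close>

definition static_lws_algorithm ::
  "nat \<Rightarrow> nat \<Rightarrow> nat \<Rightarrow> nat \<Rightarrow> (int list \<Rightarrow> real) \<Rightarrow> (nat \<Rightarrow> nat \<Rightarrow> real) \<Rightarrow> bool" where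
  "static_lws_algorithm k d c b dec f \<longleftrightarrow>
     (\<exists>P c' C. \<forall>n w e a N inp.
        lws_instance k d c b dec n w e \<and>
        N \<ge> 1 \<and> int k \<le> a \<and> a + int N \<le> int (k * n) \<and>
        static_input k d b n w e a N inp \<longrightarrow>
        (\<exists>t m. exec (word_size c' n) inp P (\<lambda>_. 0) t m \<and> real t \<le> C * f n N \<and>
           (\<forall>js\<in>strip n k (a + int N) (a + 2 * int N).
              stored_at m (2 * table_index n js) (static_T n w a N js))))"

end

theory Submission imports Defs begin

text \<open>Number the diagonals from 0. For \<open>t = 1, 2, \<dots>\<close> let \<open>N\<close> be the largest power of two dividing \<open>t\<close> and
  apply the static algorithm from the diagonals \<open>[t - N, t)\<close> to \<open>[t, t + N)\<close>, merging its output into the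
  table by minima. Any two diagonals \<open>r < s\<close> are separated by such a \<open>t \<le> s\<close>, so a
  diagonal is final when it is first needed. This is divide and conquer without recursion, and since it goes
  down to \<open>N = 1\<close>, the weights are only ever evaluated by the static algorithm; there is no other way
  to evaluate them, because \<open>dec\<close> is arbitrary. Half of the calls have \<open>N = 1\<close>, so each call may only
  touch the \<open>O(N n\<^sup>k\<^sup>-\<^sup>1)\<close> entries of its strips: its memory is reset by time stamps and its input is
  not written out but computed on access. As the values \<open>N\<close> sum to \<open>O(n log n)\<close>, the total time is
  \<open>O(n\<^sup>k\<^sup>+\<^sup>1\<^sup>-\<^sup>\<epsilon> log n)\<close> for \<open>\<epsilon> \<le> 1\<close>.\<close>


section \<open>Lowest set bits\<close>

text \<open>A tensor with a real rank decomposition never takes the value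
  \<open>\<infinity>\<close>, so every true value \<open>T\<close> is an integer. Hence all flag
  words in the table of a static input are 0, and only the number words have to be supplied. The
  result \<open>T'\<close> of a single call can still be \<open>\<infinity>\<close>, when no
  candidate lies in its strip; therefore results are merged under a flag test and the table keeps
  flags of its own. The midpoint \<open>t\<close> of a call also serves as its time stamp. The cap
  \<open>\<epsilon> \<le> 1\<close> keeps the exponent of \<open>N\<close> at least 1, so that
  merging, whose cost is linear in the size of the strip, never dominates the static call.\<close>

fun lowbit :: "nat \<Rightarrow> nat" where
  "lowbit t = (if t = 0 then 0 else if odd t then 1 else 2 * lowbit (t div 2))"

declare lowbit.simps [simp del]

lemma lowbit_odd: "odd t \<Longrightarrow> lowbit t = 1"
  by (subst lowbit.simps) (auto elim: oddE)

lemma lowbit_double: "lowbit (2 * t) = 2 * lowbit t"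
  by (cases "t = 0") (subst lowbit.simps, simp)+

lemma lowbit_pos: "t > 0 \<Longrightarrow> lowbit t > 0"
proof (induction t rule: less_induct)
  case (less t)
  then show ?case
    by (cases "odd t") (auto simp: lowbit_odd lowbit_double elim!: evenE)
qed

lemma lowbit_le: "lowbit t \<le> t"
proof (induction t rule: less_induct)
  case (less t)
  show ?case
  proof (cases "odd t")
    case True
    then show ?thesis by (auto simp: lowbit_odd elim: oddE)
  next
    case False
    then obtain s where s: "t = 2 * s" by blast
    then show ?thesis using less.IH[of s] by (cases "s = 0") (auto simp: lowbit_double lowbit.simps)
  qed
qed

text \<open>In two's complement, negation flips all bits above the lowest set bit and keeps the
  others, so the program obtains \<open>N\<close> from \<open>t\<close> by one bitwise
  conjunction.\<close>

lemma and_uminus_eq_lowbit: "and (int t) (- int t) = int (lowbit t)"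
proof (induction t rule: less_induct)
  case (less t)
  show ?case
  proof (cases "odd t")
    case True
    then obtain s where s: "t = 2 * s + 1" by (elim oddE)
    \<comment> \<open>For odd \<open>t\<close> the bits of \<open>t\<close> and \<open>- t\<close>
      above bit 0 are complementary, so only bit 0 survives.\<close>
    have "- int t div 2 = not (int s)"
      using s by (simp add: not_int_def)
    moreover have "int t div 2 = int s" using s by simp
    ultimately show ?thesis
      using True by (subst and_int_rec) (simp add: lowbit_odd)
  next
    case False
    then obtain s where s: "t = 2 * s" by blast
    show ?thesis
    proof (cases "s = 0")
      case True
      then show ?thesis using s lowbit_le[of 0] by simp
    next
      case False
      have "- int t div 2 = - int s" "int t div 2 = int s" using s by simp_all
      then show ?thesis
        using less.IH[of s] s False by (subst and_int_rec) (simp add: lowbit_double)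
    qed
  qed
qed

text \<open>\<open>lowbit t\<close> is the half width of the dyadic interval whose midpoint is \<open>t\<close>; the witness is the
  interval at which \<open>r\<close> and \<open>s\<close> separate.\<close>

lemma lowbit_separates:
  assumes "r < s"
  shows "\<exists>t>0. t \<le> r + lowbit t \<and> r < t \<and> t \<le> s \<and> s < t + lowbit t"
  using assms
proof (induction s arbitrary: r rule: less_induct)
  case (less s)
  show ?case
  \<comment> \<open>If the halves differ, doubling their interval gives one that contains
    \<open>r\<close> and \<open>s\<close>. Otherwise \<open>r\<close> and \<open>s\<close> differ in
    bit 0 only, and \<open>s\<close> itself is the midpoint.\<close>
  proof (cases "r div 2 < s div 2")
    case True
    with less.prems have "s div 2 < s" by simp
    from less.IH[OF this True] obtain t where
      "t > 0" "t \<le> r div 2 + lowbit t" "r div 2 < t" "t \<le> s div 2" "s div 2 < t + lowbit t"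
      by blast
    then show ?thesis by (intro exI[of _ "2 * t"]) (auto simp: lowbit_double)
  next
    case False
    then have "r div 2 = s div 2" using less.prems by linarith
    then have "odd s" "r + 1 = s" using less.prems by presburger+
    then show ?thesis by (intro exI[of _ s]) (auto simp: lowbit_odd)
  qed
qed

text \<open>The \<open>m - m div 2\<close> odd numbers contribute 1 each, and the even ones are the
  doubles of \<open>1, ..., m div 2\<close>.\<close>

lemma sum_lowbit_halve:
  "(\<Sum>t\<in>{1..m}. lowbit t) = m - m div 2 + 2 * (\<Sum>t\<in>{1..m div 2}. lowbit t)"
proof (induction m)
  case (Suc m)
  show ?case
  proof (cases "odd m")
    case True
    then obtain s where s: "m = 2 * s + 1" by (elim oddE)
    have "lowbit (Suc m) = 2 * lowbit (Suc s)"
      using s lowbit_double[of "Suc s"] by simp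
    then show ?thesis using Suc.IH s by simp
  next
    case False
    then show ?thesis using Suc.IH by (auto simp: lowbit_odd elim!: evenE)
  qed
qed simp

text \<open>Each of the \<open>h\<close> levels of the halving contributes at most \<open>m\<close>.
  This is the source of the logarithmic factor.\<close>

lemma sum_lowbit_le: "m < 2 ^ h \<Longrightarrow> (\<Sum>t\<in>{1..m}. lowbit t) \<le> m * h"
proof (induction h arbitrary: m)
  case (Suc h)
  have IH: "(\<Sum>t\<in>{1..m div 2}. lowbit t) \<le> (m div 2) * h"
    using Suc by (intro Suc.IH) auto
  have "(\<Sum>t\<in>{1..m}. lowbit t) \<le> m - m div 2 + 2 * ((m div 2) * h)"
    using IH unfolding sum_lowbit_halve[of m] by linarith
  also have "m - m div 2 + 2 * ((m div 2) * h) \<le> m + m * h"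
  proof -
    have "2 * (m div 2) * h \<le> m * h" by (intro mult_right_mono) auto
    then show ?thesis by (simp only: mult.assoc)
  qed
  also have "\<dots> = m * Suc h" by simp
  finally show ?case .
qed simp


section \<open>The table after the static calls\<close>

definition integral :: "ereal \<Rightarrow> bool" where
  "integral v \<longleftrightarrow> v = \<infinity> \<or> (\<exists>z. v = ereal (of_int z))"

lemma integral_min: "integral u \<Longrightarrow> integral v \<Longrightarrow> integral (min u v)"
  by (simp add: min_def)

text \<open>A finite nonempty set attains its infimum, and the empty set has infimum
  \<open>\<infinity>\<close>, so \<open>-\<infinity>\<close> cannot arise.\<close>

lemma integral_Inf:
  assumes "finite A" "\<And>v. v \<in> A \<Longrightarrow> integral v"
  shows "integral (Inf A)"
proof (cases "A = {}")
  case True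
  then show ?thesis by (simp add: integral_def top_ereal_def)
next
  case False
  with assms(1) have "Inf A = Min A" by (simp add: cInf_eq_Min)
  with False assms show ?thesis by (metis Min_in)
qed

lemma integral_add: "integral u \<Longrightarrow> integral v \<Longrightarrow> integral (u + v)"
  by (auto simp: integral_def) (metis of_int_add)

text \<open>The floor in \<open>enc_num\<close> is exact on these values, so the program may compare
  number words once both values are known to be finite.\<close>

lemma enc_num_less_iff:
  assumes "integral u" "integral v" "u \<noteq> \<infinity>" "v \<noteq> \<infinity>"
  shows "enc_num u < enc_num v \<longleftrightarrow> u < v"
  using assms by (auto simp: integral_def enc_num_def)

section \<open>Index cubes and their diagonals\<close>

lemma cubeD: "js \<in> cube n k \<Longrightarrow> length js = k" "js \<in> cube n k \<Longrightarrow> l < k \<Longrightarrow> 1 \<le> js ! l \<and> js ! l \<le> n"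
  by (auto simp: cube_def dest!: nth_mem)

lemma cube_update: "js \<in> cube n k \<Longrightarrow> 1 \<le> i \<Longrightarrow> i \<le> n \<Longrightarrow> js[l := i] \<in> cube n k"
  unfolding cube_def using set_update_subset_insert[of js l i] by auto

lemma cube_snoc: "js \<in> cube n k \<Longrightarrow> 1 \<le> i \<Longrightarrow> i \<le> n \<Longrightarrow> js @ [i] \<in> cube n (k + 1)"
  by (auto simp: cube_def)

lemma sum_list_remove_nth:
  "l < length js \<Longrightarrow> int (sum_list js) = int (js ! l) + (\<Sum>t\<in>{..<length js} - {l}. int (js ! t))"
  by (simp add: sum_list_sum_nth atLeast0LessThan sum.remove)

text \<open>The sum on the right is the \<open>J\<close> of \<open>static_T\<close>: the range of
  \<open>i\<close> there says exactly that \<open>js[l := i]\<close> lies on a diagonal in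
  \<open>[a, a + N)\<close>.\<close>

lemma sum_list_update_nth:
  "l < length js \<Longrightarrow>
    int (sum_list (js[l := i])) = int i + (\<Sum>t\<in>{..<length js} - {l}. int (js ! t))"
  by (simp add: sum_list_remove_nth[of l])

lemma cube_sum_list_ge:
  assumes "js \<in> cube n k"
  shows "k \<le> sum_list js" and "sum_list js = k \<Longrightarrow> js = replicate k 1"
proof -
  have *: "length js \<le> sum_list js \<and> (sum_list js = length js \<longrightarrow> js = replicate (length js) 1)"
    if "set js \<subseteq> {1..n}" for js :: "nat list"
    using that by (induction js) auto
  show "k \<le> sum_list js" and "sum_list js = k \<Longrightarrow> js = replicate k 1"
    using *[of js] assms by (auto simp: cube_def)
qed

section \<open>Finiteness of \<open>T\<close> and its comparison with \<open>T'\<close>\<close>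

context
  fixes n k :: nat and w :: "nat \<Rightarrow> nat list \<Rightarrow> ereal"
  assumes w_int: "\<And>l is. l < k \<Longrightarrow> is \<in> cube n (k + 1) \<Longrightarrow> \<exists>z. w l is = ereal (of_int z)"
begin

text \<open>A tuple other than all ones has an entry above 1, and lowering it to 1 gives a finite
  candidate. The minimum is attained, so it is one of the integer candidates.\<close>

lemma lws_T_int: "js \<in> cube n k \<Longrightarrow> \<exists>z. lws_T w js = ereal (of_int z)"
proof (induction "sum_list js" arbitrary: js rule: less_induct)
  case less
  note len = cubeD(1)[OF less.prems]
  show ?case
  proof (cases "js = replicate k 1")
    case True
    then show ?thesis
      using len by (intro exI[of _ 0]) (simp add: lws_T.simps)
  next
    case False
    have fin: "\<exists>z. lws_T w (js[l := i]) + w l (js @ [i]) = ereal (of_int z)"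
      if l: "l < k" and i: "i \<in> {1..<js ! l}" for l i
    proof -
      have i': "1 \<le> i" "i \<le> n" using cubeD(2)[OF less.prems l] i by auto
      have "sum_list (js[l := i]) < sum_list js"
        using sum_list_update_nth[of l js i] sum_list_remove_nth[of l js] l len i by simp
      from less.hyps[OF this cube_update[OF less.prems i']]
      obtain y where y: "lws_T w (js[l := i]) = ereal (of_int y)" by blast
      obtain z where z: "w l (js @ [i]) = ereal (of_int z)"
        using w_int[OF l cube_snoc[OF less.prems i']] by blast
      show ?thesis by (rule exI[of _ "y + z"]) (simp add: y z)
    qed
    have rec: "lws_T w js = (INF l\<in>{..<k}. INF i\<in>{1..<js ! l}. lws_T w (js[l := i]) + w l (js @ [i]))"
      using False len by (subst lws_T.simps) simp
    have "integral (lws_T w (js[l := i]) + w l (js @ [i]))" if "l < k" "i \<in> {1..<js ! l}" for l i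
      using fin[OF that] by (auto simp: integral_def)
    then have "integral (lws_T w js)"
      unfolding rec by (intro integral_Inf) (auto intro!: integral_Inf)
    moreover have "lws_T w js \<noteq> \<infinity>"
    proof -
      obtain l where l: "l < k" "js ! l \<noteq> 1"
        using False len by (metis nth_equalityI nth_replicate length_replicate)
      then have "1 \<in> {1..<js ! l}" using cubeD(2)[OF less.prems l(1)] by auto
      from fin[OF l(1) this] obtain z where "lws_T w (js[l := 1]) + w l (js @ [1]) = ereal (of_int z)"
        by blast
      moreover have "lws_T w js \<le> lws_T w (js[l := 1]) + w l (js @ [1])"
        unfolding rec using l(1) \<open>1 \<in> {1..<js ! l}\<close> by (meson INF_lower2 lessThan_iff order_refl)
      ultimately show ?thesis by auto
    qed
    ultimately show ?thesis by (auto simp: integral_def)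
  qed
qed

text \<open>Here \<open>\<infinity>\<close> does occur: for \<open>k = 3\<close>,
  \<open>a = 3\<close>, \<open>N = 2\<close> the tuple \<open>(2, 2, 2)\<close> has no candidate in
  the known strip.\<close>

lemma static_T_integral:
  assumes js: "js \<in> cube n k"
  shows "integral (static_T n w a N js)"
proof -
  have "integral (lws_T w (js[l := i]) + w l (js @ [i]))" if "l < k" "i \<in> {1..n}" for l i
  proof -
    have i: "1 \<le> i" "i \<le> n" using that by auto
    show ?thesis
      using lws_T_int[OF cube_update[OF js i]] w_int[OF \<open>l < k\<close> cube_snoc[OF js i]]
      by (intro integral_add) (auto simp: integral_def)
  qed
  then show ?thesis
    using cubeD(1)[OF js] unfolding static_T_def Let_def
    by (intro integral_Inf) (auto intro!: integral_Inf)
qed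

lemma static_T_le:
  assumes js: "js \<in> cube n k" and l: "l < k" and i: "1 \<le> i" "i \<le> n"
    and "a \<le> int (sum_list (js[l := i]))" "int (sum_list (js[l := i])) < a + int N"
  shows "static_T n w a N js \<le> lws_T w (js[l := i]) + w l (js @ [i])"
proof -
  let ?J = "\<Sum>t\<in>{..<length js} - {l}. int (js ! t)"
  have "i \<in> {i \<in> {1..n}. a - ?J \<le> int i \<and> int i < a + int N - ?J}"
    using assms cubeD(1)[OF js] sum_list_update_nth[of l js i] by auto
  then show ?thesis
    unfolding static_T_def Let_def using l cubeD(1)[OF js]
    by (meson INF_lower2 lessThan_iff order_refl)
qed

lemma lws_T_le_static_T:
  assumes js: "js \<in> cube n k" and a: "a + int N \<le> int (sum_list js)" and "js \<noteq> replicate k 1"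
  shows "lws_T w js \<le> static_T n w a N js"
proof -
  note len = cubeD(1)[OF js]
  have rec: "lws_T w js = (INF l\<in>{..<k}. INF i\<in>{1..<js ! l}. lws_T w (js[l := i]) + w l (js @ [i]))"
    using assms(3) len by (subst lws_T.simps) simp
  have "lws_T w js \<le> lws_T w (js[l := i]) + w l (js @ [i])"
    if l: "l < k" and i: "i \<in> {1..n}"
      "int i < a + int N - (\<Sum>t\<in>{..<length js} - {l}. int (js ! t))" for l i
  proof -
    have "i \<in> {1..<js ! l}"
      using sum_list_remove_nth[of l js] l len i a by simp
    then show ?thesis
      unfolding rec using l by (meson INF_lower2 lessThan_iff order_refl)
  qed
  then show ?thesis
    unfolding static_T_def Let_def len by (intro INF_greatest) auto
qed

end

text \<open>\<open>partial_T n w k m js\<close> is the table entry after the static calls with midpoints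
  \<open>k + 1, \<dots>, k + m\<close>.\<close>

primrec partial_T :: "nat \<Rightarrow> (nat \<Rightarrow> nat list \<Rightarrow> ereal) \<Rightarrow> nat \<Rightarrow> nat \<Rightarrow> nat list \<Rightarrow> ereal" where
  "partial_T n w k 0 js = (if js = replicate k 1 then 0 else \<infinity>)"
| "partial_T n w k (Suc m) js =
    (if js \<in> strip n k (int k + int (Suc m)) (int k + int (Suc m) + int (lowbit (Suc m)))
     then min (partial_T n w k m js)
       (static_T n w (int k + int (Suc m) - int (lowbit (Suc m))) (lowbit (Suc m)) js)
     else partial_T n w k m js)"

text \<open>Later merges only lower entries, so the contribution of a call remains an upper
  bound.\<close>

lemma partial_T_le_static:
  assumes "t > 0" "t \<le> m" "js \<in> strip n k (int k + int t) (int k + int t + int (lowbit t))"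
  shows "partial_T n w k m js \<le> static_T n w (int k + int t - int (lowbit t)) (lowbit t) js"
  using assms
proof (induction m)
  case (Suc m)
  show ?case
  proof (cases "t = Suc m")
    case True
    with Suc.prems(3) show ?thesis by (auto intro: min.cobounded2)
  next
    case False
    then have "partial_T n w k m js \<le> static_T n w (int k + int t - int (lowbit t)) (lowbit t) js"
      using Suc by simp
    then show ?thesis by (auto intro: min.coboundedI1)
  qed
qed simp

context
  fixes n k :: nat and w :: "nat \<Rightarrow> nat list \<Rightarrow> ereal"
  assumes w_int: "\<And>l is. l < k \<Longrightarrow> is \<in> cube n (k + 1) \<Longrightarrow> \<exists>z. w l is = ereal (of_int z)"
begin

lemma partial_T_integral: "js \<in> cube n k \<Longrightarrow> integral (partial_T n w k m js)"
proof (induction m)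
  case 0
  then show ?case by (auto simp: integral_def intro: exI[of _ 0])
next
  case (Suc m)
  then show ?case using static_T_integral[OF w_int] by (auto intro!: integral_min)
qed

text \<open>Every merged value is a minimum over candidates of the recurrence, so no entry drops
  below its true value.\<close>

lemma lws_T_le_partial_T:
  assumes js: "js \<in> cube n k"
  shows "lws_T w js \<le> partial_T n w k m js"
proof (induction m)
  case 0
  show ?case using cubeD(1)[OF js] by (simp add: lws_T.simps)
next
  case (Suc m)
  show ?case
  proof (cases "js \<in> strip n k (int k + int (Suc m)) (int k + int (Suc m) + int (lowbit (Suc m)))")
    case True
    then have "int k + int (Suc m) \<le> int (sum_list js)" by (simp add: strip_def)
    \<comment> \<open>The strip starts after diagonal \<open>k\<close>, the diagonal of the all-ones
      tuple.\<close>
    moreover from this have "js \<noteq> replicate k 1" by (auto simp: sum_list_replicate)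
    ultimately have "lws_T w js \<le>
        static_T n w (int k + int (Suc m) - int (lowbit (Suc m))) (lowbit (Suc m)) js"
      using js w_int by (intro lws_T_le_static_T) auto
    then show ?thesis using Suc by simp
  next
    case False
    then show ?thesis using Suc by (simp del: of_nat_Suc)
  qed
qed

text \<open>Since \<open>static_T\<close> refers to the true values of \<open>T\<close>, it is
  enough to find, for each candidate, one call that covers it. That the program knows the values
  which a call reads is in turn an instance of this lemma, for the calls made before.\<close>

lemma partial_T_complete:
  assumes js: "js \<in> cube n k" and sum: "sum_list js \<le> k + m"
  shows "partial_T n w k m js = lws_T w js"
proof (rule antisym)
  show "lws_T w js \<le> partial_T n w k m js" by (rule lws_T_le_partial_T[OF js])
  note len = cubeD(1)[OF js]
  show "partial_T n w k m js \<le> lws_T w js"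
  proof (cases "js = replicate k 1")
    case True
    have "partial_T n w k m js \<le> 0" for m
      using True by (induction m) (auto intro: min.coboundedI1)
    then show ?thesis using True by (simp add: lws_T.simps)
  next
    case False
    have "partial_T n w k m js \<le> lws_T w (js[l := i]) + w l (js @ [i])"
      if l: "l < k" and i: "i \<in> {1..<js ! l}" for l i
    proof -
      have i': "1 \<le> i" "i \<le> n" using cubeD(2)[OF js l] i by auto
      define r s where "r = sum_list (js[l := i]) - k" and "s = sum_list js - k"
      have ge: "k \<le> sum_list (js[l := i])" "k \<le> sum_list js"
        using cube_sum_list_ge(1) js cube_update[OF js i'] by blast+
      have "sum_list (js[l := i]) < sum_list js"
        using sum_list_update_nth[of l js i] sum_list_remove_nth[of l js] l len i by simp
      then have "r < s" using ge by (simp add: r_def s_def)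
      from lowbit_separates[OF this] obtain t where t: "t > 0" "t \<le> r + lowbit t" "r < t" "t \<le> s"
        "s < t + lowbit t" by blast
      \<comment> \<open>The separating call has number \<open>t \<le> s \<le> m\<close>, so it has
        been made; its target strip contains diagonal \<open>s\<close>, and its source strip
        contains diagonal \<open>r\<close>.\<close>
      have "partial_T n w k m js \<le> static_T n w (int k + int t - int (lowbit t)) (lowbit t) js"
        using t ge sum js by (intro partial_T_le_static) (auto simp: strip_def s_def)
      also have "\<dots> \<le> lws_T w (js[l := i]) + w l (js @ [i])"
        using t ge i' l js w_int by (intro static_T_le) (auto simp: r_def)
      finally show ?thesis .
    qed
    moreover have "lws_T w js = (INF l\<in>{..<k}. INF i\<in>{1..<js ! l}. lws_T w (js[l := i]) + w l (js @ [i]))"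
      using False len by (subst lws_T.simps) simp
    ultimately show ?thesis by (auto intro!: INF_greatest)
  qed
qed

end


section \<open>Numbering index tuples\<close>

text \<open>The base-\<open>n\<close> digits, least significant first, each shifted by 1; this
  inverts \<open>table_index\<close>.\<close>

definition tuple :: "nat \<Rightarrow> nat \<Rightarrow> nat \<Rightarrow> nat list" where
  "tuple n k x = map (\<lambda>t. (x div n ^ t) mod n + 1) [0..<k]"

text \<open>The diagonal of the tuple numbered \<open>x\<close>, in the form that the program
  evaluates. The argument is an integer because the mask on the simulated table is also evaluated at
  addresses in front of the table, where \<open>x\<close> is negative.\<close>

definition digit_sum :: "nat \<Rightarrow> nat \<Rightarrow> int \<Rightarrow> int" where
  "digit_sum n m x = (\<Sum>t<m. (x div int n ^ t) mod int n + 1)"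

lemma tuple_Suc: "tuple n (Suc k) x = (x mod n + 1) # tuple n k (x div n)"
  unfolding tuple_def by (simp add: upt_conv_Cons map_Suc_upt[symmetric] div_mult2_eq del: upt_Suc)

lemma table_index_Cons: "table_index n (j # js) = (j - 1) + n * table_index n js"
  by (simp add: table_index_def sum.lessThan_Suc_shift sum_distrib_left algebra_simps del: sum.lessThan_Suc)

lemma digit_sum_Suc: "digit_sum n (Suc m) x = x mod int n + 1 + digit_sum n m (x div int n)"
  by (simp add: digit_sum_def sum.lessThan_Suc_shift zdiv_zmult2_eq del: sum.lessThan_Suc)

lemma sum_list_tuple: "int (sum_list (tuple n k x)) = digit_sum n k (int x)"
proof (induction k arbitrary: x)
  case 0
  show ?case by (simp add: tuple_def digit_sum_def)
next
  case (Suc k)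
  show ?case by (simp add: tuple_Suc digit_sum_Suc Suc zdiv_int zmod_int)
qed

lemma digit_sum_bounds:
  assumes "n \<ge> 1"
  shows "0 \<le> digit_sum n m x" "digit_sum n m x \<le> int (m * n)"
proof -
  show "0 \<le> digit_sum n m x"
    unfolding digit_sum_def using assms by (intro sum_nonneg) (simp add: add_nonneg_nonneg)
  have "(x div int n ^ t) mod int n + 1 \<le> int n" for t
    using assms by (simp add: zless_imp_add1_zle)
  then have "digit_sum n m x \<le> (\<Sum>t<m. int n)"
    unfolding digit_sum_def by (intro sum_mono)
  then show "digit_sum n m x \<le> int (m * n)" by simp
qed

lemma tuple_in_cube: "n \<ge> 1 \<Longrightarrow> tuple n k x \<in> cube n k"
  by (auto simp: tuple_def cube_def Suc_le_eq)

lemma table_index_tuple: "x < n ^ k \<Longrightarrow> table_index n (tuple n k x) = x"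
proof (induction k arbitrary: x)
  case 0
  then show ?case by (simp add: tuple_def table_index_def)
next
  case (Suc k)
  then have "x div n < n ^ k" by (simp add: less_mult_imp_div_less mult.commute)
  then show ?case by (simp add: tuple_Suc table_index_Cons Suc.IH)
qed

lemma cube_Suc: "js \<in> cube n (Suc k) \<Longrightarrow> \<exists>i is. js = i # is \<and> 1 \<le> i \<and> i \<le> n \<and> is \<in> cube n k"
  by (cases js) (auto simp: cube_def)

lemma tuple_table_index: "js \<in> cube n k \<Longrightarrow> tuple n k (table_index n js) = js"
proof (induction k arbitrary: js)
  case 0
  then show ?case by (simp add: tuple_def cube_def)
next
  case (Suc k)
  obtain i "is" where js: "js = i # is" "1 \<le> i" "i \<le> n" "is \<in> cube n k"
    using cube_Suc[OF Suc.prems] by blast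
  then obtain h where "i = Suc h" "h < n" by (cases i) auto
  then show ?case using js Suc.IH by (simp add: tuple_Suc table_index_Cons)
qed

lemma table_index_less: "js \<in> cube n k \<Longrightarrow> table_index n js < n ^ k"
proof (induction k arbitrary: js)
  case 0
  then show ?case by (simp add: table_index_def cube_def)
next
  case (Suc k)
  obtain i "is" where js: "js = i # is" "1 \<le> i" "i \<le> n" "is \<in> cube n k"
    using cube_Suc[OF Suc.prems] by blast
  have "table_index n js < n * (table_index n is + 1)"
    using js by (simp add: table_index_Cons)
  also have "\<dots> \<le> n * n ^ k" using Suc.IH[OF js(4)] by (intro mult_left_mono) auto
  finally show ?case by simp
qed

lemma table_index_corner: "n \<ge> 1 \<Longrightarrow> table_index n (replicate k n) = n ^ k - 1"
proof (induction k)
  case (Suc k)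
  then have "n ^ k \<ge> 1" by simp
  then have "n - 1 + n * (n ^ k - 1) = n * n ^ k - 1"
    using Suc.prems by (simp add: diff_mult_distrib2)
  then show ?case using Suc by (simp add: table_index_Cons)
qed (simp add: table_index_def)

text \<open>A strip of \<open>N\<close> diagonals is traversed by a counter \<open>u < N n\<^sup>k\<^sup>-\<^sup>1\<close>: the quotient \<open>u div N\<close> encodes
  all entries of the tuple but the first, and the remainder its diagonal.\<close>

definition slot_entry :: "nat \<Rightarrow> nat \<Rightarrow> nat \<Rightarrow> nat \<Rightarrow> nat \<Rightarrow> int" where
  "slot_entry n k \<alpha> N u = int \<alpha> + int u mod int N - digit_sum n (k - 1) (int u div int N)"

definition slot_index :: "nat \<Rightarrow> nat \<Rightarrow> nat \<Rightarrow> nat \<Rightarrow> nat \<Rightarrow> int" where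
  "slot_index n k \<alpha> N u = slot_entry n k \<alpha> N u - 1 + int n * (int u div int N)"

text \<open>A counter value dictates all entries but the first, and the diagonal then forces the
  first one. The counter value is wasted if that entry falls outside \<open>[n]\<close>; otherwise
  \<open>slot_entry\<close> minus 1 is the lowest digit and \<open>u div N\<close> supplies the
  rest.\<close>

lemma slot_index:
  assumes "k \<ge> 1" "N \<ge> 1" "u < N * n ^ (k - 1)"
    and j: "1 \<le> slot_entry n k \<alpha> N u" "slot_entry n k \<alpha> N u \<le> int n"
  shows "0 \<le> slot_index n k \<alpha> N u" "slot_index n k \<alpha> N u < int n ^ k"
    and "digit_sum n k (slot_index n k \<alpha> N u) = int \<alpha> + int u mod int N"
proof -
  let ?j = "slot_entry n k \<alpha> N u" and ?c = "u div N"
  have x: "slot_index n k \<alpha> N u = (?j - 1) + int n * int ?c"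
    by (simp add: slot_index_def zdiv_int)
  show "0 \<le> slot_index n k \<alpha> N u" unfolding x using j by (intro add_nonneg_nonneg) auto
  have "?c < n ^ (k - 1)" using assms by (simp add: less_mult_imp_div_less mult.commute)
  then have c: "int ?c + 1 \<le> int n ^ (k - 1)"
    by (metis Suc_eq_plus1 Suc_leI of_nat_Suc of_nat_le_iff of_nat_power add.commute)
  have "slot_index n k \<alpha> N u < int n * (int ?c + 1)" unfolding x using j by (simp add: algebra_simps)
  also have "\<dots> \<le> int n * int n ^ (k - 1)" using c by (intro mult_left_mono) auto
  also have "\<dots> = int n ^ k" using \<open>k \<ge> 1\<close> by (cases k) auto
  finally show "slot_index n k \<alpha> N u < int n ^ k" .
  have "slot_index n k \<alpha> N u mod int n = ?j - 1" "slot_index n k \<alpha> N u div int n = int ?c"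
    unfolding x using j by (auto simp: div_pos_pos_trivial)
  moreover have "digit_sum n k y = y mod int n + 1 + digit_sum n (k - 1) (y div int n)" for y
    using \<open>k \<ge> 1\<close> digit_sum_Suc[of n "k - 1"] by simp
  ultimately show "digit_sum n k (slot_index n k \<alpha> N u) = int \<alpha> + int u mod int N"
    by (simp add: slot_entry_def zdiv_int)
qed

lemma slot_index_surj:
  assumes "k \<ge> 1" "N \<ge> 1" "n \<ge> 1" "x < n ^ k"
    and s: "int \<alpha> \<le> digit_sum n k (int x)" "digit_sum n k (int x) < int \<alpha> + int N"
  shows "\<exists>u<N * n ^ (k - 1). 1 \<le> slot_entry n k \<alpha> N u \<and> slot_entry n k \<alpha> N u \<le> int n \<and>
    slot_index n k \<alpha> N u = int x"
proof -
  define r where "r = nat (digit_sum n k (int x) - int \<alpha>)"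
  have r: "int r = digit_sum n k (int x) - int \<alpha>" "r < N" using s by (auto simp: r_def)
  define u where "u = x div n * N + r"
  have u: "int u mod int N = int r" "int u div int N = int (x div n)"
    using r(2) by (auto simp: u_def zdiv_int[symmetric] zmod_int[symmetric])
  obtain k' where k': "k = Suc k'" using \<open>k \<ge> 1\<close> by (cases k) auto
  have "x div n < n ^ (k - 1)" using \<open>x < n ^ k\<close> k' by (simp add: less_mult_imp_div_less mult.commute)
  then have "(x div n + 1) * N \<le> n ^ (k - 1) * N" by (intro mult_right_mono) auto
  then have "u < N * n ^ (k - 1)" using r(2) by (simp add: u_def algebra_simps)
  moreover have j: "slot_entry n k \<alpha> N u = int (x mod n) + 1"
    using r(1) by (simp add: slot_entry_def u k' digit_sum_Suc zdiv_int zmod_int)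
  moreover have "slot_index n k \<alpha> N u = int x"
  proof -
    have "x mod n + n * (x div n) = x" by simp
    then have "int (x mod n) + int n * int (x div n) = int x" by (metis of_nat_add of_nat_mult)
    then show ?thesis unfolding slot_index_def j u by simp
  qed
  moreover have "int (x mod n) + 1 \<le> int n" using \<open>n \<ge> 1\<close> by (simp add: Suc_le_eq zless_imp_add1_zle)
  ultimately show ?thesis by (intro exI[of _ u]) auto
qed


section \<open>Simulating a program within a larger memory\<close>

text \<open>\<open>Load\<close> and \<open>Input\<close> get stuck on contents outside the word
  range; this invariant makes reads safe.\<close>

definition all_fit :: "nat \<Rightarrow> memory \<Rightarrow> bool" where
  "all_fit w m \<longleftrightarrow> (\<forall>p. fits w (m p))"

lemma fitsI: "\<bar>z\<bar> < 2 ^ w \<Longrightarrow> fits w z"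
  by (auto simp: fits_def)

lemma fits_mono: "fits v z \<Longrightarrow> v \<le> w \<Longrightarrow> fits w z"
  unfolding fits_def using power_increasing[of v w "2::int"] by linarith

lemma fits_zero: "fits w 0"
  by (simp add: fits_def)

lemma eval_expr_fits: "eval_expr w inp m e = Some v \<Longrightarrow> fits w v"
  by (cases e) (auto simp: check_def split: bind_splits if_splits)

lemma all_fit_update: "all_fit w m \<Longrightarrow> fits w v \<Longrightarrow> all_fit w (m(a := v))"
  by (simp add: all_fit_def)

lemma exec_all_fit: "exec w inp P m t m' \<Longrightarrow> all_fit w m \<Longrightarrow> all_fit w m'"
  by (induction rule: exec.induct) (auto intro: all_fit_update eval_expr_fits)

lemma eval_Const: "fits w z \<Longrightarrow> eval_expr w inp m (Const z) = Some z"
  by (simp add: check_def)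

lemma eval_Load: "eval_expr w inp m e = Some p \<Longrightarrow> all_fit w m \<Longrightarrow> eval_expr w inp m (Load e) = Some (m p)"
  by (simp add: check_def all_fit_def)

lemma eval_Input: "eval_expr w inp m e = Some p \<Longrightarrow> all_fit w inp \<Longrightarrow> eval_expr w inp m (Input e) = Some (inp p)"
  by (simp add: check_def all_fit_def)

lemma eval_Op:
  "eval_expr w inp m e\<^sub>1 = Some x \<Longrightarrow> eval_expr w inp m e\<^sub>2 = Some y \<Longrightarrow> apply_op f x y = z \<Longrightarrow> fits w z \<Longrightarrow>
    eval_expr w inp m (Op f e\<^sub>1 e\<^sub>2) = Some z"
  by (simp add: check_def)

text \<open>The work memory is split into eight interleaved arrays. Array 0 holds the memory of the
  simulated program and array 1 the number of the run that wrote the cell, so that starting a new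
  run amounts to resetting the whole simulated memory to 0 in constant time. Arrays 2 and 3 serve
  as the simulated input and array 4 as a table of flags. Array 5 contains variables; variable 0 is
  the number of the current run.\<close>

definition cell :: "int \<Rightarrow> int \<Rightarrow> int" where
  "cell r p = 8 * p + r"

lemma cell_eq_iff:
  assumes "0 \<le> r" "r < 8" "0 \<le> s" "s < 8"
  shows "cell r p = cell s q \<longleftrightarrow> r = s \<and> p = q"
  using assms unfolding cell_def by presburger

definition at_cell :: "int \<Rightarrow> expr \<Rightarrow> expr" where
  "at_cell r e = Op Add (Op Mul (Const 8) e) (Const r)"

definition var :: "int \<Rightarrow> expr" where
  "var i = Load (Const (cell 5 i))"

text \<open>Expressions have no conditional; multiplication by the outcome of the stamp test makes a
  stale cell read as 0.\<close>

definition stamped :: "expr \<Rightarrow> expr" where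
  "stamped e = Op Mul (Load (at_cell 0 e)) (Op Eq (Load (at_cell 1 e)) (var 0))"

definition stamped_value :: "memory \<Rightarrow> int \<Rightarrow> int" where
  "stamped_value M p = (if M (cell 1 p) = M (cell 5 0) then M (cell 0 p) else 0)"

lemma eval_at_cell:
  assumes "eval_expr w inp M e = Some p" "\<bar>8 * p\<bar> + 16 \<le> 2 ^ w" "0 \<le> r" "r < 8"
  shows "eval_expr w inp M (at_cell r e) = Some (cell r p)"
  using assms by (auto simp: at_cell_def cell_def check_def fits_def)

lemma eval_var:
  assumes "all_fit w M" "\<bar>8 * i\<bar> + 16 \<le> 2 ^ w"
  shows "eval_expr w inp M (var i) = Some (M (cell 5 i))"
  unfolding var_def by (intro eval_Load eval_Const fitsI assms(1)) (use assms(2) in \<open>simp add: cell_def\<close>)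

lemma eval_stamped:
  assumes "eval_expr w inp M e = Some p" "\<bar>8 * p\<bar> + 16 \<le> 2 ^ w" "all_fit w M"
  shows "eval_expr w inp M (stamped e) = Some (stamped_value M p)"
  unfolding stamped_def
proof (rule eval_Op)
  show "eval_expr w inp M (Load (at_cell 0 e)) = Some (M (cell 0 p))"
    by (intro eval_Load eval_at_cell assms) auto
  have "eval_expr w inp M (Load (at_cell 1 e)) = Some (M (cell 1 p))"
    by (intro eval_Load eval_at_cell assms) auto
  moreover have "eval_expr w inp M (var 0) = Some (M (cell 5 0))"
    using assms(2) by (intro eval_var assms) auto
  ultimately show "eval_expr w inp M (Op Eq (Load (at_cell 1 e)) (var 0)) =
      Some (of_bool (M (cell 1 p) = M (cell 5 0)))"
    using assms(2) by (intro eval_Op fitsI) auto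
  show "fits w (stamped_value M p)"
    using assms by (auto simp: stamped_value_def all_fit_def fits_zero)
qed (simp add: stamped_value_def)

text \<open>\<open>g\<close> translates accesses to the input. The result is again one expression,
  so neither the stamp tests nor a computed input cost any steps of their own.\<close>

primrec sim_expr :: "(expr \<Rightarrow> expr) \<Rightarrow> expr \<Rightarrow> expr" where
  "sim_expr g (Const z) = Const z"
| "sim_expr g (Load e) = stamped (sim_expr g e)"
| "sim_expr g (Input e) = g (sim_expr g e)"
| "sim_expr g (Op f e\<^sub>1 e\<^sub>2) = Op f (sim_expr g e\<^sub>1) (sim_expr g e\<^sub>2)"

text \<open>The address has to be saved first because it may depend on the cell that is overwritten.\<close>

primrec sim_prog :: "(expr \<Rightarrow> expr) \<Rightarrow> prog \<Rightarrow> prog" where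
  "sim_prog g Skip = Skip"
| "sim_prog g (Store p e) =
     Seq (Store (Const (cell 5 5)) (sim_expr g p))
       (Seq (Store (at_cell 0 (var 5)) (sim_expr g e)) (Store (at_cell 1 (var 5)) (var 0)))"
| "sim_prog g (Seq P Q) = Seq (sim_prog g P) (sim_prog g Q)"
| "sim_prog g (Cond e P Q) = Cond (sim_expr g e) (sim_prog g P) (sim_prog g Q)"
| "sim_prog g (While e P) = While (sim_expr g e) (sim_prog g P)"

text \<open>A simulated store writes only to arrays 0 and 1 and to variable 5, which holds the saved
  address.\<close>

definition agree :: "memory \<Rightarrow> memory \<Rightarrow> bool" where
  "agree M M' \<longleftrightarrow> (\<forall>r p. r \<in> {2, 3, 4} \<or> r = 5 \<and> p \<noteq> 5 \<longrightarrow> M' (cell r p) = M (cell r p))"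

lemma agree_refl: "agree M M"
  by (simp add: agree_def)

lemma agree_trans: "agree M M' \<Longrightarrow> agree M' M'' \<Longrightarrow> agree M M''"
  by (simp add: agree_def)

text \<open>\<open>eval_input\<close> is demanded only where the address and the word fit word size
  \<open>v\<close>, since the simulated program is stuck otherwise. \<open>G\<close> is what the
  translation of the input requires of the memory; by \<open>G_agree\<close> it survives simulated
  stores. \<open>words\<close> leaves room for addresses multiplied by 8.\<close>

locale simulation =
  fixes v w :: nat and inp sinp :: memory and g :: "expr \<Rightarrow> expr" and G :: "memory \<Rightarrow> bool"
  assumes eval_input: "\<And>M e p. all_fit w M \<Longrightarrow> G M \<Longrightarrow> eval_expr w inp M e = Some p \<Longrightarrow>
      fits v p \<Longrightarrow> fits v (sinp p) \<Longrightarrow> eval_expr w inp M (g e) = Some (sinp p)"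
    and G_agree: "\<And>M M'. G M \<Longrightarrow> agree M M' \<Longrightarrow> G M'"
    and words: "8 * 2 ^ v + 64 \<le> (2::int) ^ w"
begin

lemma v_le_w: "v \<le> w"
proof (rule ccontr)
  assume "\<not> v \<le> w"
  then have "(2::int) ^ w \<le> 2 ^ v" by (intro power_increasing) auto
  with words show False by (smt (verit) zero_less_power)
qed

lemma word_large: "72 \<le> (2::int) ^ w"
proof -
  have "1 \<le> (2::int) ^ v" by simp
  then show ?thesis using words by linarith
qed

lemma fits_address: "fits v p \<Longrightarrow> \<bar>8 * p\<bar> + 16 \<le> 2 ^ w"
  using words by (auto simp: fits_def)

text \<open>As no stamp exceeds the current run number, incrementing that number makes every cell
  stale at once.\<close>

definition sim :: "memory \<Rightarrow> memory \<Rightarrow> bool" where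
  "sim m M \<longleftrightarrow> m = stamped_value M \<and> (\<forall>p. M (cell 1 p) \<le> M (cell 5 0)) \<and> all_fit w M \<and> G M"

lemma sim_expr_correct:
  assumes "sim m M"
  shows "eval_expr v sinp m e = Some z \<Longrightarrow> eval_expr w inp M (sim_expr g e) = Some z"
proof (induction e arbitrary: z)
  case (Const z')
  then show ?case using fits_mono[OF _ v_le_w] by (auto simp: check_def split: if_splits)
next
  case (Load e)
  then obtain p where p: "eval_expr v sinp m e = Some p" "z = m p"
    by (auto simp: check_def split: bind_splits if_splits)
  then show ?case
    using Load.IH[OF p(1)] assms fits_address[OF eval_expr_fits[OF p(1)]]
    by (simp add: eval_stamped sim_def)
next
  case (Input e)
  then obtain p where p: "eval_expr v sinp m e = Some p" "z = sinp p" "fits v z"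
    by (auto simp: check_def split: bind_splits if_splits)
  then show ?case
    using Input.IH[OF p(1)] assms eval_expr_fits[OF p(1)] by (simp add: eval_input sim_def)
next
  case (Op f e\<^sub>1 e\<^sub>2)
  then obtain x y where xy: "eval_expr v sinp m e\<^sub>1 = Some x" "eval_expr v sinp m e\<^sub>2 = Some y"
    "z = apply_op f x y" "fits v z"
    by (auto simp: check_def split: bind_splits if_splits)
  then show ?case
    using Op.IH(1)[OF xy(1)] Op.IH(2)[OF xy(2)] fits_mono[OF _ v_le_w] by (simp add: check_def)
qed

lemma sim_store:
  assumes M: "sim m M" and p: "eval_expr v sinp m p = Some a" and e: "eval_expr v sinp m e = Some z"
  shows "\<exists>M'. exec w inp (sim_prog g (Store p e)) M 3 M' \<and> sim (m(a := z)) M' \<and> agree M M'"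
proof -
  define M1 where "M1 = M(cell 5 5 := a)"
  define M2 where "M2 = M1(cell 0 a := z)"
  define M3 where "M3 = M2(cell 1 a := M (cell 5 0))"
  have fit: "all_fit w M" using M by (simp add: sim_def)
  have fits: "fits w a" "fits w z"
    using p e by (auto dest!: eval_expr_fits intro: fits_mono[OF _ v_le_w])
  have fit1: "all_fit w M1" "all_fit w M2" "all_fit w M3"
    using fit fits by (auto simp: M1_def M2_def M3_def all_fit_def)
  have agree: "agree M M1" "agree M M2" "agree M M3"
    by (auto simp: agree_def M1_def M2_def M3_def cell_eq_iff)
  have G: "G M" using M by (simp add: sim_def)
  have m: "m = stamped_value M" using M by (simp add: sim_def)
  \<comment> \<open>Saving the address leaves the simulated memory intact, so the value to be stored
    can still be evaluated afterwards.\<close>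
  have "sim m M1"
    using M fit1 G_agree[OF G agree(1)]
    by (auto simp: sim_def M1_def stamped_value_def fun_eq_iff cell_eq_iff)
  note e1 = sim_expr_correct[OF this e]
  note a_small = fits_address[OF eval_expr_fits[OF p]]
  have v5: "eval_expr w inp M' (var 5) = Some (M' (cell 5 5))"
    "eval_expr w inp M' (var 0) = Some (M' (cell 5 0))" if "all_fit w M'" for M'
    using word_large by (auto intro: eval_var[OF that])
  have "exec w inp (Store (Const (cell 5 5)) (sim_expr g p)) M 1 M1"
    unfolding M1_def using sim_expr_correct[OF M p] word_large
    by (intro exec.Store eval_Const fitsI) (auto simp: cell_def)
  moreover have "exec w inp (Store (at_cell 0 (var 5)) (sim_expr g e)) M1 1 M2"
    unfolding M2_def using v5[OF fit1(1)] a_small e1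
    by (intro exec.Store eval_at_cell) (auto simp: M1_def)
  moreover have "exec w inp (Store (at_cell 1 (var 5)) (var 0)) M2 1 M3"
    unfolding M3_def using v5[OF fit1(2)] a_small
    by (intro exec.Store eval_at_cell) (auto simp: M1_def M2_def cell_eq_iff)
  ultimately have "exec w inp (sim_prog g (Store p e)) M (1 + (1 + 1)) M3"
    unfolding sim_prog.simps by (intro exec.Seq)
  moreover have "sim (m(a := z)) M3"
    using M fit1 G_agree[OF G agree(3)]
    by (auto simp: sim_def M1_def M2_def M3_def stamped_value_def fun_eq_iff cell_eq_iff)
  ultimately show ?thesis using agree(3) by (intro exI[of _ M3]) (simp add: numeral_3_eq_3)
qed

text \<open>A store becomes three stores, while tests and \<open>Skip\<close> keep their cost; hence
  the factor 3.\<close>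

lemma sim_prog_correct:
  assumes "exec v sinp P m t m'" "sim m M"
  shows "\<exists>M' t'. exec w inp (sim_prog g P) M t' M' \<and> t' \<le> 3 * t \<and> sim m' M' \<and> agree M M'"
  using assms
proof (induction arbitrary: M rule: exec.induct)
  case (Skip m)
  then show ?case using exec.Skip by (intro exI[of _ M] exI[of _ 1]) (auto intro: agree_refl simp del: One_nat_def)
next
  case (Store m p a e z)
  from sim_store[OF Store.prems Store.hyps] show ?case
    by (metis mult.right_neutral order_refl)
next
  case (Seq P m t m' Q t' m'')
  from Seq.IH(1)[OF Seq.prems] obtain M' s where 1: "exec w inp (sim_prog g P) M s M'"
    "s \<le> 3 * t" "sim m' M'" "agree M M'" by blast
  from Seq.IH(2)[OF 1(3)] obtain M'' s' where 2: "exec w inp (sim_prog g Q) M' s' M''"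
    "s' \<le> 3 * t'" "sim m'' M''" "agree M' M''" by blast
  show ?case using 1 2 exec.Seq[OF 1(1) 2(1)] agree_trans[OF 1(4) 2(4)]
    by (intro exI[of _ M''] exI[of _ "s + s'"]) auto
next
  case (Cond_true m e z P t m' Q)
  from Cond_true.IH[OF Cond_true.prems] obtain M' s where 1: "exec w inp (sim_prog g P) M s M'"
    "s \<le> 3 * t" "sim m' M'" "agree M M'" by blast
  show ?case
    using 1 exec.Cond_true[OF sim_expr_correct[OF Cond_true.prems Cond_true.hyps(1)] Cond_true.hyps(2) 1(1)]
    by (intro exI[of _ M'] exI[of _ "s + 1"]) auto
next
  case (Cond_false m e Q t m' P)
  from Cond_false.IH[OF Cond_false.prems] obtain M' s where 1: "exec w inp (sim_prog g Q) M s M'"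
    "s \<le> 3 * t" "sim m' M'" "agree M M'" by blast
  show ?case
    using 1 exec.Cond_false[OF sim_expr_correct[OF Cond_false.prems Cond_false.hyps(1)] 1(1)]
    by (intro exI[of _ M'] exI[of _ "s + 1"]) auto
next
  case (While_true m e z P t m' t' m'')
  from While_true.IH(1)[OF While_true.prems] obtain M' s where 1: "exec w inp (sim_prog g P) M s M'"
    "s \<le> 3 * t" "sim m' M'" "agree M M'" by blast
  from While_true.IH(2)[OF 1(3)] obtain M'' s' where 2: "exec w inp (sim_prog g (While e P)) M' s' M''"
    "s' \<le> 3 * t'" "sim m'' M''" "agree M' M''" by blast
  show ?case
    using 1 2 agree_trans[OF 1(4) 2(4)]
      exec.While_true[OF sim_expr_correct[OF While_true.prems While_true.hyps(1)] While_true.hyps(2) 1(1)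
        2(1)[unfolded sim_prog.simps]]
    by (intro exI[of _ M''] exI[of _ "s + s' + 1"]) auto
next
  case (While_false m e P)
  show ?case
    using While_false.prems exec.While_false[OF sim_expr_correct[OF While_false.prems While_false.hyps]]
    by (intro exI[of _ M] exI[of _ 1]) (auto intro: agree_refl)
qed

end


section \<open>Total correctness with time bounds\<close>

definition runs :: "nat \<Rightarrow> memory \<Rightarrow> prog \<Rightarrow> memory \<Rightarrow> real \<Rightarrow> (memory \<Rightarrow> bool) \<Rightarrow> bool" where
  "runs w inp P m T Q \<longleftrightarrow> (\<exists>t m'. exec w inp P m t m' \<and> real t \<le> T \<and> Q m')"

lemma runs_mono: "runs w inp P m S Q \<Longrightarrow> S \<le> T \<Longrightarrow> (\<And>m'. Q m' \<Longrightarrow> R m') \<Longrightarrow> runs w inp P m T R"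
  unfolding runs_def by (meson order_trans)

lemma runs_Skip: "Q m \<Longrightarrow> runs w inp Skip m 1 Q"
  unfolding runs_def using exec.Skip by (metis of_nat_1 order_refl)

lemma runs_Store:
  "eval_expr w inp m p = Some a \<Longrightarrow> eval_expr w inp m e = Some v \<Longrightarrow> Q (m(a := v)) \<Longrightarrow>
    runs w inp (Store p e) m 1 Q"
  unfolding runs_def using exec.Store by (metis of_nat_1 order_refl)

text \<open>Nesting the second program in the postcondition of the first, as with weakest
  preconditions, leaves the intermediate memory anonymous.\<close>

lemma runs_Seq:
  assumes "runs w inp P m S (\<lambda>m'. runs w inp Q m' T R)"
  shows "runs w inp (Seq P Q) m (S + T) R"
proof -
  obtain t m' where 1: "exec w inp P m t m'" "real t \<le> S" "runs w inp Q m' T R"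
    using assms by (auto simp: runs_def)
  then obtain t' m'' where "exec w inp Q m' t' m''" "real t' \<le> T" "R m''"
    by (auto simp: runs_def)
  then show ?thesis
    unfolding runs_def using 1 exec.Seq[OF 1(1)] by (intro exI[of _ "t + t'"] exI[of _ m'']) auto
qed

lemma runs_Store_Seq:
  assumes "eval_expr w inp m p = Some a" "eval_expr w inp m e = Some v" "m' = m(a := v)"
    "runs w inp Q m' T R"
  shows "runs w inp (Seq (Store p e) Q) m (1 + T) R"
  using assms(4) unfolding assms(3) by (intro runs_Seq runs_Store[OF assms(1,2)])

lemma runs_Cond:
  assumes "eval_expr w inp m e = Some v" "v \<noteq> 0 \<Longrightarrow> runs w inp P m T R" "v = 0 \<Longrightarrow> runs w inp Q m T R"
  shows "runs w inp (Cond e P Q) m (T + 1) R"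
proof (cases "v = 0")
  case True
  then obtain t m' where "exec w inp Q m t m'" "real t \<le> T" "R m'" using assms(3) by (auto simp: runs_def)
  then show ?thesis
    unfolding runs_def using exec.Cond_false[of w inp m e Q t m' P] assms(1) True
    by (intro exI[of _ "t + 1"] exI[of _ m']) auto
next
  case False
  then obtain t m' where "exec w inp P m t m'" "real t \<le> T" "R m'" using assms(2) by (auto simp: runs_def)
  then show ?thesis
    unfolding runs_def using exec.Cond_true[of w inp m e v P t m' Q] assms(1) False
    by (intro exI[of _ "t + 1"] exI[of _ m']) auto
qed

text \<open>The number \<open>K\<close> of iterations is fixed in advance and the invariant carries
  the iteration number, so that the cost may depend on it: iteration \<open>i\<close> of the main
  loop is charged according to \<open>lowbit (Suc i)\<close>.\<close>

lemma runs_While: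
  assumes step: "\<And>i m. i < K \<Longrightarrow> I i m \<Longrightarrow>
      (\<exists>v. eval_expr w inp m e = Some v \<and> v \<noteq> 0) \<and> runs w inp P m (T i) (I (Suc i))"
    and stop: "\<And>m. I K m \<Longrightarrow> eval_expr w inp m e = Some 0"
    and "I 0 m"
  shows "runs w inp (While e P) m ((\<Sum>i<K. T i + 1) + 1) (I K)"
proof -
  \<comment> \<open>Generalized to a loop entered at iteration \<open>j\<close>, for induction from
    \<open>K\<close> downwards.\<close>
  have "runs w inp (While e P) m ((\<Sum>i\<in>{j..<K}. T i + 1) + 1) (I K)" if "j \<le> K" "I j m" for j m
    using that
  proof (induction arbitrary: m rule: inc_induct)
    case base
    then show ?case
      unfolding runs_def using exec.While_false[OF stop] by (intro exI[of _ 1] exI[of _ m]) auto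
  next
    case (step j)
    obtain v where v: "eval_expr w inp m e = Some v" "v \<noteq> 0" and "runs w inp P m (T j) (I (Suc j))"
      using assms(1) step by blast
    then obtain t m' where 1: "exec w inp P m t m'" "real t \<le> T j" "I (Suc j) m'"
      by (auto simp: runs_def)
    obtain t' m'' where 2: "exec w inp (While e P) m' t' m''"
      "real t' \<le> (\<Sum>i\<in>{Suc j..<K}. T i + 1) + 1" "I K m''"
      using step.IH[OF 1(3)] by (auto simp: runs_def)
    have "(\<Sum>i\<in>{j..<K}. T i + 1) = T j + 1 + (\<Sum>i\<in>{Suc j..<K}. T i + 1)"
      using step.hyps by (simp add: sum.atLeast_Suc_lessThan)
    then show ?case
      unfolding runs_def using 1 2 exec.While_true[OF v 1(1) 2(1)]
      by (intro exI[of _ "t + t' + 1"] exI[of _ m'']) auto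
  qed
  from this[of 0 m] show ?thesis using assms(3) by (simp add: atLeast0LessThan)
qed

lemma eval_arith:
  assumes "eval_expr w inp m e\<^sub>1 = Some x" "eval_expr w inp m e\<^sub>2 = Some y"
  shows "fits w (x + y) \<Longrightarrow> eval_expr w inp m (Op Add e\<^sub>1 e\<^sub>2) = Some (x + y)"
    and "fits w (x - y) \<Longrightarrow> eval_expr w inp m (Op Sub e\<^sub>1 e\<^sub>2) = Some (x - y)"
    and "fits w (x * y) \<Longrightarrow> eval_expr w inp m (Op Mul e\<^sub>1 e\<^sub>2) = Some (x * y)"
    and "fits w (x div y) \<Longrightarrow> eval_expr w inp m (Op Div e\<^sub>1 e\<^sub>2) = Some (x div y)"
    and "fits w (x mod y) \<Longrightarrow> eval_expr w inp m (Op Mod e\<^sub>1 e\<^sub>2) = Some (x mod y)"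
  using assms by (simp_all add: check_def)

lemma eval_test:
  assumes "eval_expr w inp m e\<^sub>1 = Some x" "eval_expr w inp m e\<^sub>2 = Some y" "1 \<le> w"
  shows "eval_expr w inp m (Op Less e\<^sub>1 e\<^sub>2) = Some (of_bool (x < y))"
    and "eval_expr w inp m (Op Eq e\<^sub>1 e\<^sub>2) = Some (of_bool (x = y))"
proof -
  have "(1::int) < 2 ^ w" using \<open>1 \<le> w\<close> by simp
  then have "fits w (of_bool c)" for c by (auto simp: fits_def)
  then show "eval_expr w inp m (Op Less e\<^sub>1 e\<^sub>2) = Some (of_bool (x < y))"
    "eval_expr w inp m (Op Eq e\<^sub>1 e\<^sub>2) = Some (of_bool (x = y))"
    using assms by (simp_all add: check_def)
qed

lemma fits_div: "fits w x \<Longrightarrow> 1 \<le> y \<Longrightarrow> fits w (x div y)"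
proof -
  assume x: "fits w x" and y: "1 \<le> y"
  have "- (2 ^ w) \<le> x div y"
  proof (cases "x \<ge> 0")
    case True
    then have "0 \<le> x div y" using y by (simp add: pos_imp_zdiv_nonneg_iff)
    then show ?thesis by (smt (verit) zero_less_power)
  next
    case False
    then have "x div 1 \<le> x div y" using y by (intro zdiv_mono2_neg) auto
    then show ?thesis using x by (simp add: fits_def)
  qed
  moreover have "x div y < 2 ^ w"
  proof (cases "x \<ge> 0")
    case True
    then have "x div y \<le> x div 1" using y by (intro zdiv_mono2) auto
    then show ?thesis using x by (simp add: fits_def)
  next
    case False
    then have "x div y \<le> 0" using y by (simp add: div_nonpos_pos_le0)
    then show ?thesis by (smt (verit) zero_less_power)
  qed
  ultimately show ?thesis by (simp add: fits_def)
qed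

section \<open>The program\<close>

definition size_expr :: expr where
  "size_expr = Input (Const 0)"

primrec power_expr :: "nat \<Rightarrow> expr" where
  "power_expr 0 = Const 1"
| "power_expr (Suc t) = Op Mul size_expr (power_expr t)"

primrec digit_sum_expr :: "nat \<Rightarrow> expr \<Rightarrow> expr" where
  "digit_sum_expr 0 e = Const 0"
| "digit_sum_expr (Suc m) e =
     Op Add (digit_sum_expr m e)
       (Op Add (Op Mod (Op Div e (power_expr m)) size_expr) (Const 1))"

definition strip_start :: expr where
  "strip_start = Load (Const (cell 2 1))"

definition table_base :: "nat \<Rightarrow> nat \<Rightarrow> nat \<Rightarrow> expr" where
  "table_base k d b = Op Add (Const 3) (Op Mul (Const (int (k * (k + 1) * d * b))) size_expr)"

text \<open>The input of the static algorithm is not copied: its vectors are the ones of the given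
  instance shifted by 2, its first three words are corrected by array 2, and of the table in array
  3 only the entries on the known strip are visible.\<close>

definition input_expr :: "nat \<Rightarrow> nat \<Rightarrow> nat \<Rightarrow> expr \<Rightarrow> expr" where
  "input_expr k d b e =
    (let s = digit_sum_expr k (Op Div (Op Sub e (table_base k d b)) (Const 2)) in
     Op Add (Op Add (Input (Op Sub e (Const 2))) (Load (at_cell 2 e)))
       (Op Mul (Load (at_cell 3 e))
         (Op Mul (Op Less (Op Sub strip_start (Const 1)) s) (Op Less s (Op Add strip_start (var 1))))))"

text \<open>Variables 0 to 4 hold the midpoint (and run number), \<open>N\<close>, the counter
  \<open>u\<close>, the first entry of the current tuple and its table index.\<close>

definition slot_quotient :: expr where
  "slot_quotient = Op Div (var 2) (var 1)"

definition entry_expr :: "nat \<Rightarrow> expr" where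
  "entry_expr k = Op Sub (Op Add (Op Add (Const (int k)) (var 0)) (Op Mod (var 2) (var 1)))
     (digit_sum_expr (k - 1) slot_quotient)"

definition index_expr :: expr where
  "index_expr = Op Add (Op Sub (var 3) (Const 1)) (Op Mul size_expr slot_quotient)"

definition flag_result :: expr where
  "flag_result = stamped (Op Mul (Const 2) (var 4))"

definition num_result :: expr where
  "num_result = stamped (Op Add (Op Mul (Const 2) (var 4)) (Const 1))"

definition table_address :: "nat \<Rightarrow> nat \<Rightarrow> nat \<Rightarrow> expr" where
  "table_address k d b =
     at_cell 3 (Op Add (table_base k d b) (Op Add (Op Mul (Const 2) (var 4)) (Const 1)))"

text \<open>Products act as conjunctions, and the sum as a disjunction because a test only asks for
  a nonzero value. Nothing is short-circuited: all parts have to evaluate even if variable 4 is no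
  valid table index.\<close>

definition better_expr :: "nat \<Rightarrow> nat \<Rightarrow> nat \<Rightarrow> expr" where
  "better_expr k d b =
    Op Mul
      (Op Mul (Op Less (Const 0) (var 3)) (Op Less (var 3) (Op Add size_expr (Const 1))))
      (Op Mul (Op Eq flag_result (Const 0))
        (Op Add (Op Eq (Load (at_cell 4 (var 4))) (Const 0))
          (Op Less num_result (Load (table_address k d b)))))"

definition merge_slot :: "nat \<Rightarrow> nat \<Rightarrow> nat \<Rightarrow> prog" where
  "merge_slot k d b =
    Seq (Store (Const (cell 5 3)) (entry_expr k))
   (Seq (Store (Const (cell 5 4)) index_expr)
   (Seq (Cond (better_expr k d b)
          (Seq (Store (at_cell 4 (var 4)) (Const 1)) (Store (table_address k d b) num_result))
          Skip)
     (Store (Const (cell 5 2)) (Op Add (var 2) (Const 1)))))"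

definition static_step :: "nat \<Rightarrow> nat \<Rightarrow> nat \<Rightarrow> prog \<Rightarrow> prog" where
  "static_step k d b P =
    Seq (Store (Const (cell 5 1)) (Op And (var 0) (Op Sub (Const 0) (var 0))))
   (Seq (Store (Const (cell 2 0)) size_expr)
   (Seq (Store (Const (cell 2 1)) (Op Sub (Op Add (Const (int k)) (var 0)) (var 1)))
   (Seq (Store (Const (cell 2 2)) (Op Sub (var 1) size_expr))
   (Seq (Store (Const (cell 5 2)) (Const 0))
   (Seq (sim_prog (input_expr k d b) P)
   (Seq (While (Op Less (var 2) (Op Mul (var 1) (power_expr (k - 1)))) (merge_slot k d b))
     (Store (Const (cell 5 0)) (Op Add (var 0) (Const 1)))))))))"

text \<open>Array 4 marks finite entries by 1, so the initial zero memory already represents a table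
  full of \<open>\<infinity>\<close>, and one store enters the value 0 at the all-ones tuple. The
  main loop has one midpoint for each of the \<open>k * (n - 1)\<close> diagonals after the
  first.\<close>

definition lws_prog :: "nat \<Rightarrow> nat \<Rightarrow> nat \<Rightarrow> prog \<Rightarrow> prog" where
  "lws_prog k d b P =
    Seq (Store (Const (cell 4 0)) (Const 1))
   (Seq (Store (Const (cell 5 0)) (Const 1))
   (Seq (While (Op Less (var 0) (Op Add (Op Mul (Const (int k)) (Op Sub size_expr (Const 1))) (Const 1)))
          (static_step k d b P))
   (Seq (Store (Const (cell 5 4)) (Op Sub (power_expr k) (Const 1)))
   (Seq (Store (Const 0) (Const 0)) (Store (Const 1) (Load (table_address k d b)))))))"


section \<open>The layout of the reduction\<close>

text \<open>\<open>K\<close> bounds, up to constant factors, all quantities that the program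
  computes with; the factor 1000 leaves room for those constants, such as the 8 of the memory
  layout. \<open>v\<close> is the word size of the static algorithm and \<open>W\<close> that of the
  new program.\<close>

locale reduction =
  fixes k d b n v W :: nat and w :: "nat \<Rightarrow> nat list \<Rightarrow> ereal" and e :: encoding
    and inp :: memory and K :: int
  assumes k_pos: "k \<ge> 1" and n_pos: "n \<ge> 1"
    and w_int: "\<And>l is. l < k \<Longrightarrow> is \<in> cube n (k + 1) \<Longrightarrow> \<exists>z. w l is = ereal (of_int z)"
    and input: "lws_input k d b n e inp" and inp_fit: "all_fit W inp"
    and K_large: "16 \<le> K" "int k * int n ^ k \<le> K" "int (k * (k + 1) * d * b) \<le> K"
      "int (vec_words k d b n) \<le> K" "2 ^ v \<le> K"
    and word: "1000 * K \<le> 2 ^ W"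
begin

lemma fits_small: "\<bar>z\<bar> \<le> 900 * K \<Longrightarrow> fits W z"
  using word K_large(1) by (intro fitsI) linarith

lemma address_small: "\<bar>p\<bar> \<le> 100 * K \<Longrightarrow> \<bar>8 * p\<bar> + 16 \<le> 2 ^ W"
  using word K_large(1) by linarith

lemma W_pos: "1 \<le> W"
  using word K_large(1) by (cases W) auto

lemma power_le_K: "t \<le> k \<Longrightarrow> int n ^ t \<le> K"
proof -
  assume "t \<le> k"
  then have "int n ^ t \<le> int n ^ k" using n_pos by (intro power_increasing) auto
  also have "1 * int n ^ k \<le> int k * int n ^ k" using k_pos by (intro mult_right_mono) auto
  then have "int n ^ k \<le> int k * int n ^ k" by simp
  finally show ?thesis using K_large(2) by simp
qed

lemma n_le_K: "int n \<le> K"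
  using power_le_K[of 1] k_pos by simp

lemma k_n_le_K: "int (k * n) \<le> K"
proof -
  have "int n ^ 1 \<le> int n ^ k" using n_pos k_pos by (intro power_increasing) auto
  then have "int k * int n \<le> int k * int n ^ k" by (intro mult_left_mono) auto
  then show ?thesis using K_large(2) by simp
qed

lemma k_le_K: "int k \<le> K"
proof -
  have "int k * 1 \<le> int k * int n ^ k" using n_pos by (intro mult_left_mono) auto
  then show ?thesis using K_large(2) by simp
qed

section \<open>Evaluation without overflow\<close>

abbreviation ev :: "memory \<Rightarrow> expr \<Rightarrow> int option" where
  "ev M x \<equiv> eval_expr W inp M x"

lemma ev_const: "\<bar>z\<bar> \<le> 900 * K \<Longrightarrow> ev M (Const z) = Some z"
  by (intro eval_Const fits_small)

lemma ev_var: "all_fit W M \<Longrightarrow> \<bar>i\<bar> \<le> 100 * K \<Longrightarrow> ev M (var i) = Some (M (cell 5 i))"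
  by (intro eval_var address_small)

lemma ev_at_cell: "ev M x = Some p \<Longrightarrow> \<bar>p\<bar> \<le> 100 * K \<Longrightarrow> 0 \<le> r \<Longrightarrow> r < 8 \<Longrightarrow> ev M (at_cell r x) = Some (cell r p)"
  by (intro eval_at_cell address_small)

lemma ev_stamped: "ev M x = Some p \<Longrightarrow> \<bar>p\<bar> \<le> 100 * K \<Longrightarrow> all_fit W M \<Longrightarrow> ev M (stamped x) = Some (stamped_value M p)"
  by (intro eval_stamped address_small)

lemmas ev_test = eval_test[OF _ _ W_pos, of inp]

lemma ev_size: "ev M size_expr = Some (int n)"
proof -
  have "ev M (Const 0) = Some 0" using K_large(1) by (intro ev_const) auto
  from eval_Input[OF this inp_fit] show ?thesis
    using input by (simp add: size_expr_def lws_input_def)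
qed

lemma ev_power: "t \<le> k \<Longrightarrow> ev M (power_expr t) = Some (int n ^ t)"
proof (induction t)
  case 0
  then show ?case using K_large(1) ev_const[of 1 M] by simp
next
  case (Suc t)
  have "\<bar>int n * int n ^ t\<bar> \<le> 900 * K"
    using power_le_K[OF Suc.prems] K_large(1) by simp
  then show ?case
    using Suc by (simp only: power_expr.simps power_Suc) (intro eval_arith ev_size fits_small; simp)
qed

text \<open>\<open>z\<close> may be any representable word, also a negative one: dividing it by a
  power of \<open>n\<close> stays in range, and the remainders are below \<open>n\<close>.\<close>

lemma ev_digit_sum:
  assumes "ev M x = Some z"
  shows "m \<le> k \<Longrightarrow> ev M (digit_sum_expr m x) = Some (digit_sum n m z)"
proof (induction m)
  case 0
  then show ?case using K_large(1) ev_const[of 0 M] by (simp add: digit_sum_def)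
next
  case (Suc m)
  let ?r = "(z div int n ^ m) mod int n"
  have r: "0 \<le> ?r" "?r < int n" using n_pos by auto
  have s: "0 \<le> digit_sum n m z" "digit_sum n m z \<le> K"
  proof -
    have "int (m * n) \<le> int (k * n)" using Suc.prems by (simp only: of_nat_le_iff) simp
    then show "0 \<le> digit_sum n m z" "digit_sum n m z \<le> K"
      using digit_sum_bounds[OF n_pos, of m z] k_n_le_K by linarith+
  qed
  have "ev M (digit_sum_expr (Suc m) x) = Some (digit_sum n m z + (?r + 1))"
    unfolding digit_sum_expr.simps
  proof (intro eval_arith ev_size ev_power assms Suc.IH ev_const)
    show "fits W (z div int n ^ m)"
      using eval_expr_fits[OF assms] n_pos by (intro fits_div) auto
    show "fits W ?r" "fits W (?r + 1)" "fits W (digit_sum n m z + (?r + 1))"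
      using r s n_le_K K_large(1) by (auto intro!: fits_small)
  qed (use Suc.prems K_large(1) in auto)
  then show ?case by (simp add: digit_sum_def algebra_simps)
qed

section \<open>The table and the simulated static input\<close>

definition base :: int where
  "base = 3 + int (vec_words k d b n)"

lemma base_bounds: "3 \<le> base" "base \<le> 2 * K"
  using K_large unfolding base_def by auto

lemma ev_table_base: "ev M (table_base k d b) = Some base"
proof -
  have vec: "int (k * (k + 1) * d * b) * int n = int (vec_words k d b n)"
    by (simp add: vec_words_def)
  have "ev M (table_base k d b) = Some (3 + int (k * (k + 1) * d * b) * int n)"
    unfolding table_base_def
  proof (intro eval_arith ev_size ev_const)
    show "fits W (int (k * (k + 1) * d * b) * int n)" "fits W (3 + int (k * (k + 1) * d * b) * int n)"
      unfolding vec using K_large by (auto intro!: fits_small)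
    show "\<bar>int (k * (k + 1) * d * b)\<bar> \<le> 900 * K" "\<bar>3\<bar> \<le> 900 * K" using K_large by linarith+
  qed
  then show ?thesis by (simp only: vec base_def)
qed

text \<open>Entry \<open>x\<close> of the table is stored where the static algorithm expects its number.\<close>

definition slot :: "nat \<Rightarrow> int" where
  "slot x = base + (2 * int x + 1)"

text \<open>Array 3 has to vanish outside the slots because it is added to the other parts of the
  simulated input. Flags are inverted, in accordance with memory that is initially 0.\<close>

definition holds_table :: "(nat \<Rightarrow> ereal) \<Rightarrow> memory \<Rightarrow> bool" where
  "holds_table U M \<longleftrightarrow>
    (\<forall>x<n ^ k. M (cell 3 (slot x)) = enc_num (U x) \<and> M (cell 4 (int x)) = 1 - enc_flag (U x)) \<and>
    (\<forall>p. p \<notin> slot ` {..<n ^ k} \<longrightarrow> M (cell 3 p) = 0)"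

lemma slot_eq_iff: "slot x = slot y \<longleftrightarrow> x = y"
  by (simp add: slot_def)

lemma holds_table_cong:
  assumes "holds_table U M" "\<And>x. x < n ^ k \<Longrightarrow> U x = U' x"
    "\<And>r p. r \<in> {3, 4} \<Longrightarrow> M' (cell r p) = M (cell r p)"
  shows "holds_table U' M'"
  using assms by (auto simp: holds_table_def)

lemma holds_table_update:
  assumes "holds_table U M" "y < n ^ k" "z \<noteq> \<infinity>"
    "M' = M(cell 4 (int y) := 1, cell 3 (slot y) := enc_num z)"
  shows "holds_table (U(y := z)) M'"
  using assms by (auto simp: holds_table_def cell_eq_iff slot_eq_iff enc_flag_def)

text \<open>Once the arrays are set up, the summands have disjoint supports except at address 2, so
  the sum overlays them. Flag words receive no contribution and read as 0.\<close>

definition strip_input :: "memory \<Rightarrow> int \<Rightarrow> int" where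
  "strip_input M p = inp (p - 2) + M (cell 2 p) +
    M (cell 3 p) * (of_bool (M (cell 2 1) - 1 < digit_sum n k ((p - base) div 2)) *
      of_bool (digit_sum n k ((p - base) div 2) < M (cell 2 1) + M (cell 5 1)))"

lemma strip_input_agree: "agree M M' \<Longrightarrow> strip_input M' = strip_input M"
  by (auto simp: strip_input_def agree_def)

text \<open>The instance shifted by 2 shows \<open>inp 0\<close>, which is \<open>n\<close>, at
  address 2; the entry \<open>N - n\<close> turns this into \<open>N\<close>. At addresses 0 and 1
  it shows 0.\<close>

definition prepared :: "int \<Rightarrow> nat \<Rightarrow> memory \<Rightarrow> bool" where
  "prepared a N M \<longleftrightarrow> M (cell 2 0) = int n \<and> M (cell 2 1) = a \<and> M (cell 2 2) = int N - int n \<and>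
     M (cell 5 1) = int N \<and> (\<forall>p. p \<notin> {0, 1, 2} \<longrightarrow> M (cell 2 p) = 0)"

lemma inp_neg: "p < 0 \<Longrightarrow> inp p = 0"
  using input by (simp add: lws_input_def)

lemma inp_0: "inp 0 = int n"
  using input by (simp add: lws_input_def)

lemma ev_input_expr:
  assumes M: "all_fit W M" and prep: "prepared a N M" and a: "0 \<le> a" "a \<le> K" "int N \<le> K"
    and x: "ev M x = Some p" "fits v p" "fits v (strip_input M p)"
  shows "ev M (input_expr k d b x) = Some (strip_input M p)"
proof -
  let ?s = "digit_sum n k ((p - base) div 2)"
  have p: "\<bar>p\<bar> \<le> K" using x(2) K_large(5) by (auto simp: fits_def)
  \<comment> \<open>The sum of two arbitrary words could overflow, but array 2 vanishes beyond the
    three corrected addresses.\<close>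
  have "fits W (inp (p - 2) + M (cell 2 p))"
  proof (cases "p \<in> {0, 1, 2}")
    case True
    have c: "M (cell 2 0) = int n" "M (cell 2 1) = a" "M (cell 2 2) = int N - int n"
      using prep by (auto simp: prepared_def)
    have "\<bar>inp (p - 2) + M (cell 2 p)\<bar> \<le> K"
      using True a n_le_K inp_neg[of "-2"] inp_neg[of "-1"] inp_0 by (elim insertE) (simp_all add: c)
    then show ?thesis using K_large(1) by (intro fits_small) linarith
  next
    case False
    then show ?thesis using prep inp_fit by (simp add: prepared_def all_fit_def)
  qed
  moreover have "fits W (strip_input M p)"
    using x(3) K_large(1,5) by (intro fits_small) (auto simp: fits_def)
  moreover have "fits W (M (cell 3 p) * (of_bool s * of_bool t))" "fits W (of_bool s * of_bool t)" for s t
    using M K_large(1) by (auto simp: all_fit_def fits_zero intro: fits_small)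
  moreover have start: "ev M strip_start = Some a"
  proof -
    have "ev M (Const (cell 2 1)) = Some (cell 2 1)"
      using K_large(1) by (intro ev_const) (simp add: cell_def)
    from eval_Load[OF this M] show ?thesis using prep by (simp add: strip_start_def prepared_def)
  qed
  moreover have N: "ev M (var 1) = Some (int N)"
    using ev_var[OF M, of 1] K_large(1) prep by (simp add: prepared_def)
  moreover have "fits W ((p - base) div 2)"
    using p base_bounds by (intro fits_div fits_small) auto
  then have "ev M (Op Div (Op Sub x (table_base k d b)) (Const 2)) = Some ((p - base) div 2)"
    using p base_bounds K_large(1) by (intro eval_arith x ev_table_base ev_const fits_small) auto
  note s = ev_digit_sum[OF this order_refl]
  have eq: "strip_input M p = inp (p - 2) + M (cell 2 p) +
      M (cell 3 p) * (of_bool (a - 1 < ?s) * of_bool (?s < a + int N))"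
    using prep by (simp add: strip_input_def prepared_def)
  show ?thesis
    unfolding input_expr_def Let_def eq
  proof (intro eval_arith ev_test eval_Input eval_Load ev_at_cell x ev_const start N s M inp_fit)
    show "fits W (p - 2)" "fits W (a - 1)" "fits W (a + int N)"
      using p a K_large(1) by (auto intro!: fits_small)
  qed (use calculation p K_large(1) in \<open>auto simp: eq\<close>)
qed

lemma vector_index_less:
  assumes "l < k" "t < k + 1" "i \<in> {1..n}" "s < d" "r < b"
  shows "(((l * (k + 1) + t) * n + (i - 1)) * d + s) * b + r < vec_words k d b n"
proof -
  \<comment> \<open>One digit of a mixed-radix numeral; \<open>vec_words\<close> is the product of
    the radices.\<close>
  have step: "x * m + y < z * m" if "x < z" "y < m" for x y z m :: nat
  proof -
    have "x * m + y < (x + 1) * m" using that by simp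
    also have "\<dots> \<le> z * m" using that by (intro mult_right_mono) auto
    finally show ?thesis .
  qed
  show ?thesis
    unfolding vec_words_def using assms by (intro step) auto
qed

text \<open>\<open>U\<close> has to be correct on the known strip only, since the mask hides the
  unfinished rest of the table.\<close>

lemma static_input_strip_input:
  assumes prep: "prepared a N M" and a: "int k \<le> a"
    and tab: "holds_table U M"
    and U: "\<And>x. x < n ^ k \<Longrightarrow> tuple n k x \<in> strip n k a (a + int N) \<Longrightarrow> U x = lws_T w (tuple n k x)"
  shows "static_input k d b n w e a N (strip_input M)"
proof -
  have c2: "M (cell 2 p) = 0" if "p \<notin> {0, 1, 2}" for p
    using that prep by (simp add: prepared_def)
  have c3: "M (cell 3 p) = 0" if "p \<notin> slot ` {..<n ^ k}" for p
    using that tab by (simp add: holds_table_def)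
  have low: "M (cell 3 p) = 0" if "p < base" for p
    using that by (intro c3) (auto simp: slot_def)
  have inp_out: "inp p = 0" if "p < 0 \<or> p \<ge> base - 2" for p
    using that input by (auto simp: lws_input_def base_def)
  have c: "M (cell 2 0) = int n" "M (cell 2 1) = a" "M (cell 2 2) = int N - int n" "M (cell 5 1) = int N"
    using prep by (auto simp: prepared_def)
  have "strip_input M 0 = int n" "strip_input M 1 = a" "strip_input M 2 = int N"
    using base_bounds inp_0 inp_neg by (simp_all add: strip_input_def low c)
  moreover have "vectors_at k d b n e (strip_input M) 3"
    unfolding vectors_at_def
  proof (intro allI impI ballI)
    fix l t i s r
    assume *: "l < k" "t < k + 1" "i \<in> {1..n}" "s < d" "r < b"
    let ?x = "(((l * (k + 1) + t) * n + (i - 1)) * d + s) * b + r"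
    have "strip_input M (int (3 + y)) = inp (int (1 + y))" if "y < vec_words k d b n" for y
      using that low[of "int (3 + y)"] c2[of "int (3 + y)"] by (simp add: strip_input_def base_def)
    from this[OF vector_index_less[OF *]]
    have "strip_input M (int (3 + ?x)) = inp (int (1 + ?x))" .
    also have "\<dots> = e l t i s r"
      using input * unfolding lws_input_def vectors_at_def by blast
    finally show "strip_input M (int (3 + ?x)) = e l t i s r" .
  qed
  moreover have "stored_at (strip_input M) (3 + vec_words k d b n + 2 * table_index n js)
      (if js \<in> strip n k a (a + int N) then lws_T w js else 0)" if js: "js \<in> cube n k" for js
  proof -
    let ?x = "table_index n js"
    have x: "?x < n ^ k" "tuple n k ?x = js"
      using js by (auto simp: table_index_less tuple_table_index)
    have p: "int (3 + vec_words k d b n + 2 * ?x) = base + 2 * int ?x" by (simp add: base_def)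
    \<comment> \<open>Flag words have even offsets from \<open>base\<close>, slots have odd
      ones.\<close>
    have "base + 2 * int ?x \<notin> slot ` {..<n ^ k}"
    proof
      assume "base + 2 * int ?x \<in> slot ` {..<n ^ k}"
      then obtain y where "base + 2 * int ?x = slot y" by blast
      then have "2 * int ?x = 2 * int y + 1" by (simp add: slot_def)
      then show False by presburger
    qed
    then have 0: "strip_input M (base + 2 * int ?x) = 0"
      using base_bounds inp_out c2 c3 by (simp add: strip_input_def)
    have ds: "digit_sum n k (int ?x) = int (sum_list js)"
      using sum_list_tuple[of n k ?x] x by simp
    have "(base + 2 * int ?x + 1 - base) div 2 = int ?x" by simp
    then have 1: "strip_input M (base + 2 * int ?x + 1) =
        (if js \<in> strip n k a (a + int N) then enc_num (U ?x) else 0)"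
      using base_bounds inp_out c2 tab x(1) js
      unfolding strip_input_def
      by (auto simp: ds c holds_table_def slot_def strip_def add.assoc)
    \<comment> \<open>The constant flag 0 is correct because \<open>T\<close> is finite.\<close>
    obtain z where "lws_T w js = ereal (of_int z)" using lws_T_int[where w = w and n = n and k = k] w_int js by blast
    then show ?thesis
      using U[OF x(1)] x(2) unfolding stored_at_def p 0 1 by (auto simp: enc_flag_def enc_num_def)
  qed
  moreover have "strip_input M p = 0" if "p < 0 \<or> p \<ge> int (3 + vec_words k d b n + 2 * n ^ k)" for p
  proof -
    have "slot x < base + 2 * int (n ^ k)" if "x < n ^ k" for x
    proof -
      have "int x < int (n ^ k)" using that by (simp only: of_nat_less_iff)
      then show ?thesis unfolding slot_def by linarith
    qed
    moreover have "p < base \<or> p \<ge> base + 2 * int (n ^ k)" using that base_bounds(1) by (auto simp: base_def)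
    ultimately have "p \<notin> slot ` {..<n ^ k}" by (force simp: slot_def)
    moreover have p: "p < 0 \<or> base \<le> p"
    proof -
      have "base \<le> int (3 + vec_words k d b n + 2 * n ^ k)"
        unfolding base_def of_nat_add by simp
      then show ?thesis using that by linarith
    qed
    then have "p \<notin> {0, 1, 2}" using base_bounds(1) by auto
    moreover have "inp (p - 2) = 0" using p inp_out[of "p - 2"] by auto
    ultimately show ?thesis using c2 c3 by (simp add: strip_input_def)
  qed
  ultimately show ?thesis
    unfolding static_input_def by blast
qed

end


text \<open>The static algorithm on one fixed instance; as \<open>n\<close> is fixed, its time bound
  is a function of \<open>N\<close> alone.\<close>

locale static_reduction = reduction +
  fixes P :: prog and time :: "nat \<Rightarrow> real"
  assumes static: "\<And>a N sinp. 1 \<le> N \<Longrightarrow> int k \<le> a \<Longrightarrow> a + int N \<le> int (k * n) \<Longrightarrow>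
      static_input k d b n w e a N sinp \<Longrightarrow>
      \<exists>t m. exec v sinp P (\<lambda>_. 0) t m \<and> real t \<le> time N \<and>
        (\<forall>js\<in>strip n k (a + int N) (a + 2 * int N).
          stored_at m (2 * table_index n js) (static_T n w a N js))"
begin

lemma prepared_agree: "prepared a N M \<Longrightarrow> agree M M' \<Longrightarrow> prepared a N M'"
  by (auto simp: prepared_def agree_def)

lemma runs_sim_static:
  assumes M: "all_fit W M" and prep: "prepared a N M" and tab: "holds_table U M"
    and stamps: "\<And>p. M (cell 1 p) < M (cell 5 0)"
    and N: "1 \<le> N" and a: "int k \<le> a" "a + int N \<le> int (k * n)"
    and U: "\<And>x. x < n ^ k \<Longrightarrow> tuple n k x \<in> strip n k a (a + int N) \<Longrightarrow> U x = lws_T w (tuple n k x)"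
  shows "runs W inp (sim_prog (input_expr k d b) P) M (3 * time N) (\<lambda>M'.
      all_fit W M' \<and> agree M M' \<and> (\<forall>p. M' (cell 1 p) \<le> M' (cell 5 0)) \<and>
      (\<forall>js\<in>strip n k (a + int N) (a + 2 * int N).
          stored_at (stamped_value M') (2 * table_index n js) (static_T n w a N js)))"
proof -
  have "static_input k d b n w e a N (strip_input M)"
    by (rule static_input_strip_input[OF prep a(1) tab U])
  from static[OF N a this] obtain t m where run: "exec v (strip_input M) P (\<lambda>_. 0) t m"
    "real t \<le> time N" and res: "\<forall>js\<in>strip n k (a + int N) (a + 2 * int N).
          stored_at m (2 * table_index n js) (static_T n w a N js)" by blast
  \<comment> \<open>With \<open>agree M\<close> for \<open>G\<close>, the computed input remains
    throughout the run what it was at the start.\<close>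
  interpret simulation v W inp "strip_input M" "input_expr k d b" "agree M"
  proof
    show "eval_expr W inp M' (input_expr k d b x) = Some (strip_input M p)"
      if "all_fit W M'" "agree M M'" "eval_expr W inp M' x = Some p" "fits v p"
        "fits v (strip_input M p)" for M' x p
    proof -
      have "0 \<le> a" "a \<le> K" "int N \<le> K" using a k_n_le_K by auto
      then show ?thesis
        using ev_input_expr[OF that(1) prepared_agree[OF prep that(2)] _ _ _ that(3,4)]
          that(5) strip_input_agree[OF that(2)] by simp
    qed
    show "8 * 2 ^ v + 64 \<le> (2::int) ^ W" using word K_large(1,5) by linarith
  qed (rule agree_trans)
  \<comment> \<open>All stamps are strictly older than this run, so the simulated memory reads as 0
    everywhere.\<close>
  have "sim (\<lambda>_. 0) M"
    using stamps M by (auto simp: sim_def stamped_value_def fun_eq_iff agree_refl less_le)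
  from sim_prog_correct[OF run(1) this] obtain M' t' where
    "exec W inp (sim_prog (input_expr k d b) P) M t' M'" "t' \<le> 3 * t" "sim m M'" "agree M M'"
    by blast
  then show ?thesis
    unfolding runs_def using run(2) res by (intro exI[of _ t'] exI[of _ M']) (auto simp: sim_def)
qed

section \<open>Merging the output of one call\<close>

definition merged :: "nat \<Rightarrow> nat \<Rightarrow> (nat \<Rightarrow> ereal) \<Rightarrow> (nat \<Rightarrow> ereal) \<Rightarrow> nat \<Rightarrow> nat \<Rightarrow> ereal" where
  "merged \<alpha> N U S u x =
    (if \<exists>u'<u. 1 \<le> slot_entry n k \<alpha> N u' \<and> slot_entry n k \<alpha> N u' \<le> int n \<and> slot_index n k \<alpha> N u' = int x
     then min (U x) (S x) else U x)"

lemma merged_skip: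
  assumes "\<not> (1 \<le> slot_entry n k \<alpha> N u \<and> slot_entry n k \<alpha> N u \<le> int n)"
  shows "merged \<alpha> N U S (Suc u) = merged \<alpha> N U S u"
  using assms by (auto simp: merged_def less_Suc_eq fun_eq_iff)

lemma merged_update:
  assumes "1 \<le> slot_entry n k \<alpha> N u" "slot_entry n k \<alpha> N u \<le> int n" "slot_index n k \<alpha> N u = int y"
  shows "merged \<alpha> N U S (Suc u) = (merged \<alpha> N U S u)(y := min (merged \<alpha> N U S u y) (S y))"
  using assms by (auto simp: merged_def less_Suc_eq fun_eq_iff min_def)

text \<open>The part of the memory that merging reads but never writes. Results are promised only on
  the strip that starts at the midpoint.\<close>

definition merge_context :: "nat \<Rightarrow> nat \<Rightarrow> (nat \<Rightarrow> ereal) \<Rightarrow> memory \<Rightarrow> bool" where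
  "merge_context \<tau> N S M \<longleftrightarrow> M (cell 5 0) = int \<tau> \<and> M (cell 5 1) = int N \<and>
    (\<forall>p. M (cell 1 p) \<le> int \<tau>) \<and> (\<forall>p. p \<notin> {0, 1, 2} \<longrightarrow> M (cell 2 p) = 0) \<and>
    (\<forall>y<n ^ k. int (k + \<tau>) \<le> digit_sum n k (int y) \<and> digit_sum n k (int y) < int (k + \<tau>) + int N \<longrightarrow>
       stored_at (stamped_value M) (2 * y) (S y))"

lemma merge_context_cong:
  assumes "merge_context \<tau> N S M"
    "\<And>r p. r \<in> {0, 1, 2} \<or> r = 5 \<and> p \<in> {0, 1} \<Longrightarrow> M' (cell r p) = M (cell r p)"
  shows "merge_context \<tau> N S M'"
proof -
  have "stamped_value M' = stamped_value M"
    using assms(2) by (auto simp: stamped_value_def fun_eq_iff)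
  then show ?thesis using assms by (simp add: merge_context_def)
qed

definition merge_inv :: "nat \<Rightarrow> nat \<Rightarrow> (nat \<Rightarrow> ereal) \<Rightarrow> (nat \<Rightarrow> ereal) \<Rightarrow> nat \<Rightarrow> memory \<Rightarrow> bool" where
  "merge_inv \<tau> N U S u M \<longleftrightarrow> all_fit W M \<and> merge_context \<tau> N S M \<and> M (cell 5 2) = int u \<and>
     holds_table (merged (k + \<tau>) N U S u) M"

text \<open>As \<open>N \<le> k * n\<close>, the counter is at most \<open>k * n ^ k\<close>, which
  is why \<open>K\<close> has to dominate that number.\<close>

lemma counter_bounds:
  assumes N: "1 \<le> N" "int N \<le> int (k * n)" and u: "u \<le> N * n ^ (k - 1)"
  shows "int u \<le> K" "int n * (int u div int N) \<le> K" "0 \<le> int n * (int u div int N)"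
    "int N * int n ^ (k - 1) \<le> K"
proof -
  have pow: "int n * int n ^ (k - 1) = int n ^ k" using k_pos by (cases k) auto
  have "int N * int n ^ (k - 1) \<le> int (k * n) * int n ^ (k - 1)"
    using N by (intro mult_right_mono) auto
  also have "\<dots> = int k * int n ^ k" using pow by (simp add: mult.assoc)
  finally show "int N * int n ^ (k - 1) \<le> K" using K_large(2) by linarith
  moreover have "int u \<le> int (N * n ^ (k - 1))" using u by (simp only: of_nat_le_iff)
  ultimately show "int u \<le> K" by simp
  have "u div N \<le> n ^ (k - 1)"
    using div_le_mono[OF u, of N] N(1) by simp
  then have "int (u div N) \<le> int n ^ (k - 1)" by (metis of_nat_le_iff of_nat_power)
  then have "int n * (int u div int N) \<le> int n * int n ^ (k - 1)"
    by (intro mult_left_mono) (auto simp: zdiv_int)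
  then show "int n * (int u div int N) \<le> K" unfolding pow using power_le_K[of k] by simp
  show "0 \<le> int n * (int u div int N)" by (simp add: zdiv_int[symmetric])
qed

lemma ev_better:
  assumes M: "all_fit W M" and x: "\<bar>M (cell 5 4)\<bar> \<le> 10 * K"
  shows "\<exists>z. ev M (better_expr k d b) = Some z \<and> (z \<noteq> 0 \<longleftrightarrow>
      0 < M (cell 5 3) \<and> M (cell 5 3) < int n + 1 \<and> stamped_value M (2 * M (cell 5 4)) = 0 \<and>
      (M (cell 4 (M (cell 5 4))) = 0 \<or>
       stamped_value M (2 * M (cell 5 4) + 1) < M (cell 3 (base + (2 * M (cell 5 4) + 1)))))"
    (is "\<exists>z. _ = _ \<and> (_ \<longleftrightarrow> ?A \<and> ?B \<and> ?C \<and> (?D \<or> ?E))")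
proof -
  have "ev M (better_expr k d b) = Some
      ((of_bool ?A * of_bool ?B) * (of_bool ?C * (of_bool ?D + of_bool ?E)))"
    unfolding better_expr_def flag_result_def num_result_def table_address_def
  proof (intro eval_arith ev_test ev_const ev_var ev_size ev_stamped ev_at_cell ev_table_base eval_Load M)
    show "fits W (of_bool ?A * of_bool ?B)" "fits W (of_bool ?D + of_bool ?E)"
      "fits W (of_bool ?C * (of_bool ?D + of_bool ?E))"
      "fits W ((of_bool ?A * of_bool ?B) * (of_bool ?C * (of_bool ?D + of_bool ?E)))"
      using K_large(1) by (auto intro!: fits_small)
  qed (use x K_large(1) n_le_K base_bounds in \<open>auto intro!: fits_small\<close>)
  then show ?thesis by (intro exI conjI) (assumption, auto)
qed

lemma runs_merge_slot:
  assumes \<tau>: "int (k + \<tau>) \<le> K" and N: "1 \<le> N" "int N \<le> int (k * n)" and u: "u < N * n ^ (k - 1)"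
    and int: "\<And>y. y < n ^ k \<Longrightarrow> integral (U y) \<and> integral (S y)"
    and inv: "merge_inv \<tau> N U S u M"
  shows "runs W inp (merge_slot k d b) M 6 (merge_inv \<tau> N U S (Suc u))"
proof -
  let ?j = "slot_entry n k (k + \<tau>) N u" and ?x = "slot_index n k (k + \<tau>) N u"
  let ?U = "merged (k + \<tau>) N U S u"
  define M1 where "M1 = M(cell 5 3 := ?j)"
  define M2 where "M2 = M1(cell 5 4 := ?x)"
  have M: "all_fit W M" and ctx: "merge_context \<tau> N S M" and Mu: "M (cell 5 2) = int u"
    and tab: "holds_table ?U M"
    using inv by (auto simp: merge_inv_def)
  have M\<tau>: "M (cell 5 0) = int \<tau>" and MN: "M (cell 5 1) = int N" using ctx by (auto simp: merge_context_def)
  have K: "\<bar>i\<bar> \<le> 10 \<Longrightarrow> \<bar>i\<bar> \<le> 100 * K" for i using K_large(1) by linarith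
  have NK: "int N \<le> K" using N(2) k_n_le_K by linarith
  note bounds = counter_bounds[OF N less_imp_le[OF u]]
  have r: "0 \<le> int u mod int N" "int u mod int N < int N" using N(1) by auto
  have q: "0 \<le> int u div int N" by (simp add: zdiv_int[symmetric])
  have s: "0 \<le> digit_sum n (k - 1) (int u div int N)" "digit_sum n (k - 1) (int u div int N) \<le> K"
  proof -
    have "int ((k - 1) * n) \<le> int (k * n)" by (simp only: of_nat_le_iff) simp
    then show "0 \<le> digit_sum n (k - 1) (int u div int N)" "digit_sum n (k - 1) (int u div int N) \<le> K"
      using digit_sum_bounds[OF n_pos, of "k - 1" "int u div int N"] k_n_le_K by linarith+
  qed
  have j: "\<bar>?j\<bar> \<le> 3 * K" using r s \<tau> NK unfolding slot_entry_def by linarith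
  have x: "\<bar>?x\<bar> \<le> 5 * K" using j bounds K_large(1) unfolding slot_index_def by linarith
  have quot: "ev M' slot_quotient = Some (int u div int N)"
    if "all_fit W M'" "M' (cell 5 2) = int u" "M' (cell 5 1) = int N" for M'
  proof -
    have "ev M' slot_quotient = Some (M' (cell 5 2) div M' (cell 5 1))"
      unfolding slot_quotient_def using that(2,3) N(1) bounds(1) K_large(1)
      by (intro eval_arith ev_var that(1) K fits_div fits_small) auto
    then show ?thesis using that by simp
  qed
  have "ev M (entry_expr k) = Some ?j"
  proof -
    have "ev M (entry_expr k) = Some (int k + M (cell 5 0) + M (cell 5 2) mod M (cell 5 1) -
        digit_sum n (k - 1) (int u div int N))"
      unfolding entry_expr_def
    proof (intro eval_arith ev_const ev_var ev_digit_sum quot M Mu MN)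
      show "fits W (int k + M (cell 5 0))" "fits W (M (cell 5 2) mod M (cell 5 1))"
        "fits W (int k + M (cell 5 0) + M (cell 5 2) mod M (cell 5 1))"
        "fits W (int k + M (cell 5 0) + M (cell 5 2) mod M (cell 5 1) -
            digit_sum n (k - 1) (int u div int N))"
        using \<tau> r NK s K_large(1) by (auto simp: M\<tau> MN Mu intro!: fits_small)
    qed (use K_large(1) k_le_K in auto)
    then show ?thesis by (simp add: M\<tau> MN Mu slot_entry_def)
  qed
  moreover have "ev M (Const (cell 5 3)) = Some (cell 5 3)"
    using K_large(1) by (intro ev_const) (simp add: cell_def)
  moreover have M1: "all_fit W M1"
    unfolding M1_def using M j K_large(1) by (intro all_fit_update fits_small) linarith+
  have M1': "M1 (cell 5 2) = int u" "M1 (cell 5 1) = int N" "M1 (cell 5 3) = ?j"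
    by (auto simp: M1_def cell_eq_iff Mu MN)
  have "ev M1 index_expr = Some ?x"
  proof -
    have "ev M1 index_expr = Some (M1 (cell 5 3) - 1 + int n * (int u div int N))"
      unfolding index_expr_def
    proof (intro eval_arith ev_const ev_var ev_size quot M1 M1')
      show "fits W (M1 (cell 5 3) - 1)" "fits W (int n * (int u div int N))"
        "fits W (M1 (cell 5 3) - 1 + int n * (int u div int N))"
        unfolding M1' using j bounds K_large(1) by (auto intro!: fits_small)
    qed (use K_large(1) in auto)
    then show ?thesis by (simp add: M1' slot_index_def)
  qed
  moreover have "ev M1 (Const (cell 5 4)) = Some (cell 5 4)"
    using K_large(1) by (intro ev_const) (simp add: cell_def)
  moreover have M2: "all_fit W M2"
    unfolding M2_def using M1 x K_large(1) by (intro all_fit_update fits_small) linarith+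
  have M2': "M2 (cell 5 2) = int u" "M2 (cell 5 3) = ?j" "M2 (cell 5 4) = ?x"
    by (auto simp: M1_def M2_def cell_eq_iff Mu)
  have M2_other: "M2 (cell r p) = M (cell r p)" if "r \<in> {0, 1, 2, 3, 4} \<or> r = 5 \<and> p \<in> {0, 1}" for r p
    using that by (auto simp: M1_def M2_def cell_eq_iff)
  have ctx2: "merge_context \<tau> N S M2"
    using ctx M2_other by (intro merge_context_cong[OF ctx]) auto
  have tab2: "holds_table ?U M2"
    using M2_other by (intro holds_table_cong[OF tab]) auto
  let ?Q = "\<lambda>M'. all_fit W M' \<and> merge_context \<tau> N S M' \<and> M' (cell 5 2) = int u \<and>
     holds_table (merged (k + \<tau>) N U S (Suc u)) M'"
  have "runs W inp (Cond (better_expr k d b)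
      (Seq (Store (at_cell 4 (var 4)) (Const 1)) (Store (table_address k d b) num_result)) Skip) M2 (2 + 1) ?Q"
  proof -
    have "\<bar>M2 (cell 5 4)\<bar> \<le> 10 * K" using x M2' K_large(1) by linarith
    from ev_better[OF M2 this] obtain z where z: "ev M2 (better_expr k d b) = Some z"
      and z_iff: "z \<noteq> 0 \<longleftrightarrow> 0 < ?j \<and> ?j < int n + 1 \<and> stamped_value M2 (2 * ?x) = 0 \<and>
      (M2 (cell 4 ?x) = 0 \<or> stamped_value M2 (2 * ?x + 1) < M2 (cell 3 (base + (2 * ?x + 1))))"
      unfolding M2' by blast
    show ?thesis
    proof (cases "1 \<le> ?j \<and> ?j \<le> int n")
      case False
      then have "z = 0" using z_iff by auto
      then show ?thesis
        using False M2 ctx2 tab2 M2'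
        by (intro runs_Cond[OF z] runs_mono[OF runs_Skip[where Q = ?Q]]) (auto simp: merged_skip)
    next
      case True
      note slot = slot_index[OF k_pos N(1) u, of "k + \<tau>"]
      obtain y where y: "?x = int y" using slot(1) True by (metis nonneg_int_cases)
      have y_less: "y < n ^ k" using slot(2) True unfolding y by (metis of_nat_less_iff of_nat_power)
      have ds: "digit_sum n k (int y) = int (k + \<tau>) + int u mod int N" using slot(3) True unfolding y by simp
      have merged: "merged (k + \<tau>) N U S (Suc u) = ?U(y := min (?U y) (S y))"
        using True y by (intro merged_update) auto
      have res: "stamped_value M2 (2 * int y) = enc_flag (S y)" "stamped_value M2 (2 * int y + 1) = enc_num (S y)"
        using ctx2 y_less ds r unfolding merge_context_def stored_at_def by auto
      have old: "M2 (cell 4 (int y)) = 1 - enc_flag (?U y)" "M2 (cell 3 (base + (2 * int y + 1))) = enc_num (?U y)"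
        using tab2 y_less by (auto simp: holds_table_def slot_def)
      have intg: "integral (?U y)" "integral (S y)"
        using int[OF y_less] by (auto simp: merged_def intro: integral_min)
      \<comment> \<open>An infinite \<open>S y\<close> fails its flag test, an infinite old entry
        has 0 in array 4, and in the remaining case the number words decide.\<close>
      have z_iff': "z \<noteq> 0 \<longleftrightarrow> S y < ?U y"
        using z_iff True enc_num_less_iff[OF intg(2,1)] unfolding y res old
        by (cases "S y = \<infinity>"; cases "?U y = \<infinity>") (auto simp: enc_flag_def less_top[symmetric] top_ereal_def)
      show ?thesis
      proof (rule runs_Cond[OF z])
        assume "z = 0"
        then have "merged (k + \<tau>) N U S (Suc u) = ?U"
          using z_iff' unfolding merged by (auto simp: fun_eq_iff min_def not_less)
        then show "runs W inp Skip M2 2 ?Q"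
          using M2 ctx2 tab2 M2' by (intro runs_mono[OF runs_Skip[where Q = ?Q]]) auto
      next
        assume "z \<noteq> 0"
        then have less: "S y < ?U y" using z_iff' by simp
        then have new: "merged (k + \<tau>) N U S (Suc u) = ?U(y := S y)" "S y \<noteq> \<infinity>"
          unfolding merged by (auto simp: min_def)
        define M3 where "M3 = M2(cell 4 (int y) := 1)"
        define M4 where "M4 = M3(cell 3 (slot y) := enc_num (S y))"
        have M3: "all_fit W M3"
          unfolding M3_def using K_large(1) by (intro all_fit_update M2 fits_small) auto
        have M3': "M3 (cell 5 4) = int y" "stamped_value M3 (2 * int y + 1) = enc_num (S y)"
          using res(2) by (auto simp: M3_def cell_eq_iff M2' y stamped_value_def)
        have "\<bar>int y\<bar> \<le> 5 * K" using x unfolding y by simp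
        have "ev M2 (at_cell 4 (var 4)) = Some (cell 4 (M2 (cell 5 4)))"
          using x K_large(1) by (intro ev_at_cell ev_var M2) (auto simp: M2')
        moreover have "ev M2 (Const 1) = Some 1" using K_large(1) by (intro ev_const) auto
        moreover have "ev M3 (table_address k d b) = Some (cell 3 (base + (2 * M3 (cell 5 4) + 1)))"
          unfolding table_address_def
          using x K_large(1) base_bounds
          by (intro ev_at_cell eval_arith ev_table_base ev_const ev_var M3 fits_small) (auto simp: M3' y)
        moreover have "ev M3 num_result = Some (stamped_value M3 (2 * M3 (cell 5 4) + 1))"
          unfolding num_result_def
          using x K_large(1)
          by (intro ev_stamped eval_arith ev_const ev_var M3 fits_small) (auto simp: M3' y)
        moreover have "?Q M4"
        proof (intro conjI)
          show "all_fit W M4"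
            unfolding M4_def using M3 eval_expr_fits[OF calculation(4)] by (intro all_fit_update) (auto simp: M3')
          show "merge_context \<tau> N S M4"
            by (rule merge_context_cong[OF ctx2]) (auto simp: M4_def M3_def cell_eq_iff)
          show "M4 (cell 5 2) = int u" by (simp add: M4_def M3_def cell_eq_iff M2')
          show "holds_table (merged (k + \<tau>) N U S (Suc u)) M4"
            unfolding new(1)
            by (rule holds_table_update[OF tab2 y_less new(2)]) (simp add: M4_def M3_def)
        qed
        ultimately have "runs W inp (Seq (Store (at_cell 4 (var 4)) (Const 1))
            (Store (table_address k d b) num_result)) M2 (1 + 1) ?Q"
          unfolding M3' M2' y
          by (intro runs_Seq runs_Store[where w = W]) (auto simp: M3_def M4_def slot_def)
        then show "runs W inp (Seq (Store (at_cell 4 (var 4)) (Const 1))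
            (Store (table_address k d b) num_result)) M2 2 ?Q" by simp
      qed
    qed
  qed
  then have "runs W inp (Cond (better_expr k d b)
      (Seq (Store (at_cell 4 (var 4)) (Const 1)) (Store (table_address k d b) num_result)) Skip) M2 (2 + 1)
      (\<lambda>M'. runs W inp (Store (Const (cell 5 2)) (Op Add (var 2) (Const 1))) M' 1 (merge_inv \<tau> N U S (Suc u)))"
  proof (rule runs_mono)
    fix M' assume M': "?Q M'"
    have "ev M' (Const (cell 5 2)) = Some (cell 5 2)"
      using K_large(1) by (intro ev_const) (simp add: cell_def)
    moreover have "ev M' (Op Add (var 2) (Const 1)) = Some (M' (cell 5 2) + 1)"
      using M' bounds(1) K_large(1) by (intro eval_arith ev_var ev_const fits_small) auto
    moreover have "merge_inv \<tau> N U S (Suc u) (M'(cell 5 2 := M' (cell 5 2) + 1))"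
      unfolding merge_inv_def
    proof (intro conjI)
      show "all_fit W (M'(cell 5 2 := M' (cell 5 2) + 1))"
        using M' bounds(1) K_large(1) by (intro all_fit_update fits_small) auto
      show "merge_context \<tau> N S (M'(cell 5 2 := M' (cell 5 2) + 1))"
        by (rule merge_context_cong[of \<tau> N S M']) (use M' in \<open>auto simp: cell_eq_iff\<close>)
      show "holds_table (merged (k + \<tau>) N U S (Suc u)) (M'(cell 5 2 := M' (cell 5 2) + 1))"
        by (rule holds_table_cong[of "merged (k + \<tau>) N U S (Suc u)" M']) (use M' in \<open>auto simp: cell_eq_iff\<close>)
    qed (use M' in simp)
    ultimately show "runs W inp (Store (Const (cell 5 2)) (Op Add (var 2) (Const 1))) M' 1
        (merge_inv \<tau> N U S (Suc u))"
      by (rule runs_Store)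
  qed simp
  ultimately have "runs W inp (merge_slot k d b) M (1 + (1 + ((2 + 1) + 1))) (merge_inv \<tau> N U S (Suc u))"
    unfolding merge_slot_def by (intro runs_Seq runs_Store[where w = W]) (auto simp: M1_def M2_def)
  then show ?thesis by simp
qed

end


section \<open>The outer loop over the midpoints\<close>

context static_reduction
begin

text \<open>After \<open>i\<close> calls, variable 0 already holds the midpoint \<open>Suc i\<close>
  of the next one, and all stamps are strictly older.\<close>

definition main_inv :: "nat \<Rightarrow> memory \<Rightarrow> bool" where
  "main_inv i M \<longleftrightarrow> all_fit W M \<and> M (cell 5 0) = int (Suc i) \<and> (\<forall>p. M (cell 1 p) < int (Suc i)) \<and>
     (\<forall>p. p \<notin> {0, 1, 2} \<longrightarrow> M (cell 2 p) = 0) \<and>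
     holds_table (\<lambda>x. partial_T n w k i (tuple n k x)) M"

text \<open>The 3 is the cost of simulation. Each merge iteration takes at most 6 steps and a loop
  test; the last 7 steps are the five stores before the run, the final loop test and the
  increment.\<close>

definition step_time :: "nat \<Rightarrow> real" where
  "step_time N = 3 * time N + 7 * (real N * real n ^ (k - 1)) + 7"

lemma ev_const_cell: "0 \<le> r \<Longrightarrow> r < 8 \<Longrightarrow> \<bar>p\<bar> \<le> 10 \<Longrightarrow> ev M (Const (cell r p)) = Some (cell r p)"
  using K_large(1) by (intro ev_const) (auto simp: cell_def)

text \<open>The counter visits exactly the tuples of the target strip, so a full traversal performs
  one recursion step of \<open>partial_T\<close>.\<close>

lemma merged_complete:
  assumes N: "N = lowbit (Suc i)" and y: "y < n ^ k"
    and S: "\<And>x. S x = static_T n w (int k + int (Suc i) - int N) N (tuple n k x)"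
    and U: "\<And>x. U x = partial_T n w k i (tuple n k x)"
  shows "merged (k + Suc i) N U S (N * n ^ (k - 1)) y = partial_T n w k (Suc i) (tuple n k y)"
proof -
  have N1: "1 \<le> N" using lowbit_pos[of "Suc i"] N by simp
  let ?\<alpha> = "k + Suc i"
  let ?v = "\<lambda>u. 1 \<le> slot_entry n k ?\<alpha> N u \<and> slot_entry n k ?\<alpha> N u \<le> int n \<and> slot_index n k ?\<alpha> N u = int y"
  have "(\<exists>u<N * n ^ (k - 1). ?v u) \<longleftrightarrow>
      int ?\<alpha> \<le> digit_sum n k (int y) \<and> digit_sum n k (int y) < int ?\<alpha> + int N"
  proof
    assume "\<exists>u<N * n ^ (k - 1). ?v u"
    then obtain u where u: "u < N * n ^ (k - 1)" "?v u" by blast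
    then have "digit_sum n k (int y) = int ?\<alpha> + int u mod int N"
      using slot_index(3)[OF k_pos N1 u(1), of ?\<alpha>] by simp
    then show "int ?\<alpha> \<le> digit_sum n k (int y) \<and> digit_sum n k (int y) < int ?\<alpha> + int N"
      using N1 by simp
  next
    assume "int ?\<alpha> \<le> digit_sum n k (int y) \<and> digit_sum n k (int y) < int ?\<alpha> + int N"
    then show "\<exists>u<N * n ^ (k - 1). ?v u"
      using slot_index_surj[OF k_pos N1 n_pos y, of ?\<alpha>] by blast
  qed
  moreover have "tuple n k y \<in> strip n k (int k + int (Suc i)) (int k + int (Suc i) + int N) \<longleftrightarrow>
      int ?\<alpha> \<le> digit_sum n k (int y) \<and> digit_sum n k (int y) < int ?\<alpha> + int N"
    using tuple_in_cube[OF n_pos] by (auto simp: strip_def sum_list_tuple)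
  ultimately show ?thesis by (simp only: merged_def partial_T.simps N[symmetric] S U)
qed

lemma runs_static_step:
  assumes i: "i < k * (n - 1)" and inv: "main_inv i M"
  shows "runs W inp (static_step k d b P) M (step_time (lowbit (Suc i))) (main_inv (Suc i))"
proof -
  define N where "N = lowbit (Suc i)"
  define a where "a = int k + int (Suc i) - int N"
  define U where "U = (\<lambda>x. partial_T n w k i (tuple n k x))"
  define S where "S = (\<lambda>x. static_T n w a N (tuple n k x))"
  \<comment> \<open>The midpoint is an existing diagonal, as the static algorithm demands.\<close>
  have "k * (n - 1) + k = k * n" using n_pos by (cases n) auto
  then have i_le: "k + Suc i \<le> k * n" using i by simp
  then have i_le_int: "int (k + Suc i) \<le> int (k * n)" by (simp only: of_nat_le_iff)
  have N1: "1 \<le> N" using lowbit_pos[of "Suc i"] by (simp add: N_def)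
  have Ni: "N \<le> Suc i" unfolding N_def by (rule lowbit_le)
  have a_bounds: "int k \<le> a" "a + int N \<le> int (k * n)" using Ni i_le_int by (auto simp: a_def)
  have NK: "int N \<le> int (k * n)" using a_bounds by linarith
  have iK: "int (k + Suc i) \<le> K" using i_le_int k_n_le_K by linarith
  have aK: "0 \<le> a" "a \<le> K" using a_bounds k_n_le_K by linarith+
  have NK': "int N \<le> K" using NK k_n_le_K by linarith
  have M: "all_fit W M" and M0: "M (cell 5 0) = int (Suc i)" and stamps: "\<And>p. M (cell 1 p) < int (Suc i)"
    and c2: "\<And>p. p \<notin> {0, 1, 2} \<Longrightarrow> M (cell 2 p) = 0" and tab: "holds_table U M"
    using inv by (auto simp: main_inv_def U_def)
  note K1 = K_large(1)
  define M1 where "M1 = M(cell 5 1 := int N)"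
  define M2 where "M2 = M1(cell 2 0 := int n)"
  define M3 where "M3 = M2(cell 2 1 := a)"
  define M4 where "M4 = M3(cell 2 2 := int N - int n)"
  define M5 where "M5 = M4(cell 5 2 := 0)"
  have fit1: "all_fit W M1" unfolding M1_def using NK' K1 by (intro all_fit_update M fits_small) auto
  have fit2: "all_fit W M2" unfolding M2_def using n_le_K K1 by (intro all_fit_update fit1 fits_small) auto
  have fit3: "all_fit W M3" unfolding M3_def using aK K1 by (intro all_fit_update fit2 fits_small) auto
  have fit4: "all_fit W M4" unfolding M4_def using n_le_K NK' K1 by (intro all_fit_update fit3 fits_small) auto
  have fit5: "all_fit W M5" unfolding M5_def using K1 by (intro all_fit_update fit4 fits_small) auto
  have v: "M1 (cell 5 0) = int (Suc i)" "M2 (cell 5 0) = int (Suc i)" "M1 (cell 5 1) = int N"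
    "M2 (cell 5 1) = int N" "M3 (cell 5 1) = int N" "M5 (cell 5 0) = int (Suc i)" "M5 (cell 5 1) = int N"
    "M5 (cell 5 2) = 0"
    using M0 by (auto simp: M1_def M2_def M3_def M4_def M5_def cell_eq_iff)
  have addr: "ev M' (Const (cell 5 1)) = Some (cell 5 1)" "ev M' (Const (cell 2 0)) = Some (cell 2 0)"
    "ev M' (Const (cell 2 1)) = Some (cell 2 1)" "ev M' (Const (cell 2 2)) = Some (cell 2 2)"
    "ev M' (Const (cell 5 2)) = Some (cell 5 2)" for M'
    by (rule ev_const_cell; simp)+
  have e1: "ev M (Op And (var 0) (Op Sub (Const 0) (var 0))) = Some (int N)"
  proof -
    have "ev M (Op Sub (Const 0) (var 0)) = Some (0 - M (cell 5 0))"
      using iK K1 by (intro eval_arith ev_const ev_var M fits_small) (auto simp: M0)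
    moreover have "ev M (var 0) = Some (M (cell 5 0))" using K1 by (intro ev_var M) auto
    ultimately show ?thesis
      using and_uminus_eq_lowbit[of "Suc i"] NK' K1 unfolding M0
      by (intro eval_Op[where f = And]) (auto simp: N_def intro!: fits_small)
  qed
  have e3: "ev M2 (Op Sub (Op Add (Const (int k)) (var 0)) (var 1)) = Some a"
  proof -
    have "ev M2 (Op Sub (Op Add (Const (int k)) (var 0)) (var 1)) = Some (int k + M2 (cell 5 0) - M2 (cell 5 1))"
      using iK aK k_le_K K1 by (intro eval_arith ev_const ev_var fit2 fits_small) (auto simp: v a_def)
    then show ?thesis by (simp add: v a_def)
  qed
  have e4: "ev M3 (Op Sub (var 1) size_expr) = Some (int N - int n)"
  proof -
    have "ev M3 (Op Sub (var 1) size_expr) = Some (M3 (cell 5 1) - int n)"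
      using NK' n_le_K K1 by (intro eval_arith ev_size ev_var fit3 fits_small) (auto simp: v)
    then show ?thesis by (simp add: v)
  qed
  have e5: "ev M4 (Const 0) = Some 0" using K1 by (intro ev_const) auto
  have sim: "runs W inp (sim_prog (input_expr k d b) P) M5 (3 * time N)
      (\<lambda>M'. runs W inp (While (Op Less (var 2) (Op Mul (var 1) (power_expr (k - 1)))) (merge_slot k d b)) M'
         ((\<Sum>u<N * n ^ (k - 1). 6 + 1) + 1)
         (\<lambda>M''. runs W inp (Store (Const (cell 5 0)) (Op Add (var 0) (Const 1))) M'' 1 (main_inv (Suc i))))"
  proof (rule runs_mono)
    show "runs W inp (sim_prog (input_expr k d b) P) M5 (3 * time N) (\<lambda>M'.
      all_fit W M' \<and> agree M5 M' \<and> (\<forall>p. M' (cell 1 p) \<le> M' (cell 5 0)) \<and>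
      (\<forall>js\<in>strip n k (a + int N) (a + 2 * int N).
          stored_at (stamped_value M') (2 * table_index n js) (static_T n w a N js)))"
    proof (rule runs_sim_static[OF fit5])
      show "prepared a N M5"
        using c2 by (auto simp: prepared_def M1_def M2_def M3_def M4_def M5_def cell_eq_iff)
      show "holds_table U M5"
        using tab by (rule holds_table_cong) (auto simp: M1_def M2_def M3_def M4_def M5_def cell_eq_iff)
      show "M5 (cell 1 p) < M5 (cell 5 0)" for p
        using stamps M0 by (auto simp: M1_def M2_def M3_def M4_def M5_def cell_eq_iff)
      \<comment> \<open>The known strip ends with diagonal \<open>k + i\<close>, and diagonals up to
        that one are final after \<open>i\<close> calls.\<close>
      show "U x = lws_T w (tuple n k x)" if "x < n ^ k" "tuple n k x \<in> strip n k a (a + int N)" for x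
        unfolding U_def using that w_int tuple_in_cube[OF n_pos]
        by (intro partial_T_complete) (auto simp: strip_def a_def)
    qed (use N1 a_bounds in auto)
  next
    fix M' assume M': "all_fit W M' \<and> agree M5 M' \<and> (\<forall>p. M' (cell 1 p) \<le> M' (cell 5 0)) \<and>
      (\<forall>js\<in>strip n k (a + int N) (a + 2 * int N).
          stored_at (stamped_value M') (2 * table_index n js) (static_T n w a N js))"
    have ctx: "merge_context (Suc i) N S M'"
      unfolding merge_context_def
    proof (intro conjI allI impI)
      show M'0: "M' (cell 5 0) = int (Suc i)" "M' (cell 5 1) = int N"
        using M' v by (auto simp: agree_def)
      show "M' (cell 1 p) \<le> int (Suc i)" for p using M' M'0 by metis
      show "M' (cell 2 p) = 0" if "p \<notin> {0, 1, 2}" for p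
      proof -
        have "M' (cell 2 p) = M5 (cell 2 p)" using M' by (auto simp: agree_def)
        then show ?thesis using that c2 by (auto simp: M1_def M2_def M3_def M4_def M5_def cell_eq_iff)
      qed
      show "stored_at (stamped_value M') (2 * y) (S y)" if "y < n ^ k"
        "int (k + Suc i) \<le> digit_sum n k (int y) \<and> digit_sum n k (int y) < int (k + Suc i) + int N" for y
      proof -
        have "tuple n k y \<in> strip n k (a + int N) (a + 2 * int N)"
          using that(2) tuple_in_cube[OF n_pos] by (auto simp: strip_def sum_list_tuple a_def)
        then show ?thesis using M' table_index_tuple[OF that(1)] unfolding S_def by metis
      qed
    qed
    have "holds_table U M'"
    proof (rule holds_table_cong[OF tab])
      fix r p :: int assume "r \<in> {3, 4}"
      then show "M' (cell r p) = M (cell r p)"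
        using M' by (auto simp: agree_def M1_def M2_def M3_def M4_def M5_def cell_eq_iff)
    qed simp
    moreover have "merged (k + Suc i) N U S 0 = U" by (simp add: merged_def fun_eq_iff)
    ultimately have "merge_inv (Suc i) N U S 0 M'"
      unfolding merge_inv_def using M' ctx v by (simp add: agree_def)
    then have "runs W inp (While (Op Less (var 2) (Op Mul (var 1) (power_expr (k - 1)))) (merge_slot k d b)) M'
         ((\<Sum>u<N * n ^ (k - 1). 6 + 1) + 1) (merge_inv (Suc i) N U S (N * n ^ (k - 1)))"
    proof (rule runs_While[rotated 2])
      have guard: "ev M'' (Op Less (var 2) (Op Mul (var 1) (power_expr (k - 1)))) =
          Some (of_bool (u < N * n ^ (k - 1)))" if "merge_inv (Suc i) N U S u M''" for u M''
      proof -
        have M'': "all_fit W M''" "M'' (cell 5 1) = int N" "M'' (cell 5 2) = int u"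
          using that by (auto simp: merge_inv_def merge_context_def)
        have "ev M'' (Op Less (var 2) (Op Mul (var 1) (power_expr (k - 1)))) =
            Some (of_bool (M'' (cell 5 2) < M'' (cell 5 1) * int n ^ (k - 1)))"
          using counter_bounds(4)[OF N1 NK, of 0] K1
          by (intro ev_test eval_arith ev_var ev_power M''(1) fits_small) (auto simp: M'')
        moreover have "int u < int N * int n ^ (k - 1) \<longleftrightarrow> u < N * n ^ (k - 1)"
          by (metis of_nat_less_iff of_nat_mult of_nat_power)
        ultimately show ?thesis by (simp add: M'')
      qed
      show "ev M'' (Op Less (var 2) (Op Mul (var 1) (power_expr (k - 1)))) = Some 0"
        if "merge_inv (Suc i) N U S (N * n ^ (k - 1)) M''" for M''
        using guard[OF that] by simp
      fix u M'' assume u: "u < N * n ^ (k - 1)" and inv: "merge_inv (Suc i) N U S u M''"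
      have "runs W inp (merge_slot k d b) M'' 6 (merge_inv (Suc i) N U S (Suc u))"
      proof (rule runs_merge_slot[OF iK N1 NK u _ inv])
        show "integral (U y) \<and> integral (S y)" for y
          unfolding U_def S_def using partial_T_integral[of k n w] static_T_integral[of k n w] w_int
            tuple_in_cube[OF n_pos] by blast
      qed
      then show "(\<exists>z. ev M'' (Op Less (var 2) (Op Mul (var 1) (power_expr (k - 1)))) = Some z \<and> z \<noteq> 0) \<and>
          runs W inp (merge_slot k d b) M'' 6 (merge_inv (Suc i) N U S (Suc u))"
        using guard[OF inv] u by simp
    qed
    then show "runs W inp (While (Op Less (var 2) (Op Mul (var 1) (power_expr (k - 1)))) (merge_slot k d b)) M'
         ((\<Sum>u<N * n ^ (k - 1). 6 + 1) + 1)
         (\<lambda>M''. runs W inp (Store (Const (cell 5 0)) (Op Add (var 0) (Const 1))) M'' 1 (main_inv (Suc i)))"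
    proof (rule runs_mono)
      fix M'' assume inv: "merge_inv (Suc i) N U S (N * n ^ (k - 1)) M''"
      then have M'': "all_fit W M''" "merge_context (Suc i) N S M''" "M'' (cell 5 0) = int (Suc i)"
        by (auto simp: merge_inv_def merge_context_def)
      have ev: "ev M'' (Op Add (var 0) (Const 1)) = Some (M'' (cell 5 0) + 1)"
        using M'' iK K1 by (intro eval_arith ev_const ev_var fits_small) auto
      have "main_inv (Suc i) (M''(cell 5 0 := M'' (cell 5 0) + 1))"
        unfolding main_inv_def
      proof (intro conjI)
        show "all_fit W (M''(cell 5 0 := M'' (cell 5 0) + 1))"
          using M'' eval_expr_fits[OF ev] by (intro all_fit_update) auto
        show "\<forall>p. (M''(cell 5 0 := M'' (cell 5 0) + 1)) (cell 1 p) < int (Suc (Suc i))"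
        proof
          fix p
          have "M'' (cell 1 p) \<le> int (Suc i)" using M''(2) by (simp add: merge_context_def)
          then show "(M''(cell 5 0 := M'' (cell 5 0) + 1)) (cell 1 p) < int (Suc (Suc i))"
            by (simp add: cell_eq_iff)
        qed
        show "\<forall>p. p \<notin> {0, 1, 2} \<longrightarrow> (M''(cell 5 0 := M'' (cell 5 0) + 1)) (cell 2 p) = 0"
          using M''(2) by (simp add: cell_eq_iff merge_context_def)
        have "holds_table (merged (k + Suc i) N U S (N * n ^ (k - 1))) M''"
          using inv by (simp add: merge_inv_def)
        then show "holds_table (\<lambda>x. partial_T n w k (Suc i) (tuple n k x)) (M''(cell 5 0 := M'' (cell 5 0) + 1))"
        proof (rule holds_table_cong)
          show "merged (k + Suc i) N U S (N * n ^ (k - 1)) y = partial_T n w k (Suc i) (tuple n k y)"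
            if "y < n ^ k" for y
            using that by (intro merged_complete) (auto simp: N_def S_def U_def a_def)
        qed (auto simp: cell_eq_iff)
      qed (simp add: M'')
      with ev_const_cell ev show "runs W inp (Store (Const (cell 5 0)) (Op Add (var 0) (Const 1))) M'' 1
          (main_inv (Suc i))"
        by (intro runs_Store) auto
    qed simp
  qed simp
  have "runs W inp (static_step k d b P) M
      (1 + (1 + (1 + (1 + (1 + (3 * time N + (((\<Sum>u<N * n ^ (k - 1). 6 + 1) + 1) + 1)))))))
      (main_inv (Suc i))"
    unfolding static_step_def
    by (rule runs_Store_Seq[OF addr(1) e1 M1_def], rule runs_Store_Seq[OF addr(2) ev_size M2_def],
        rule runs_Store_Seq[OF addr(3) e3 M3_def], rule runs_Store_Seq[OF addr(4) e4 M4_def],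
        rule runs_Store_Seq[OF addr(5) e5 M5_def], rule runs_Seq, rule runs_mono[OF sim order_refl],
        rule runs_Seq)
  then show ?thesis
    by (rule runs_mono) (simp_all add: step_time_def N_def[symmetric])
qed

lemma main_inv_initial: "main_inv 0 ((\<lambda>_. 0)(cell 4 0 := 1, cell 5 0 := 1))"
proof -
  have "tuple n k x = replicate k 1 \<longleftrightarrow> x = 0" if "x < n ^ k" for x
  proof
    have "0 < n ^ k" using n_pos by simp
    note 0 = table_index_tuple[OF this]
    have t0: "tuple n k 0 = replicate k 1" by (simp add: tuple_def map_replicate_const)
    show "tuple n k x = replicate k 1" if "x = 0" using that t0 by simp
    show "x = 0" if "tuple n k x = replicate k 1"
      using table_index_tuple[OF \<open>x < n ^ k\<close>] 0 that t0 by simp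
  qed
  then have "holds_table (\<lambda>x. partial_T n w k 0 (tuple n k x)) ((\<lambda>_. 0)(cell 4 0 := 1, cell 5 0 := 1))"
    by (auto simp: holds_table_def enc_num_def enc_flag_def cell_eq_iff)
  then show ?thesis
    using K_large(1) by (auto simp: main_inv_def cell_eq_iff all_fit_def intro!: fits_small)
qed

lemma runs_lws_prog:
  "runs W inp (lws_prog k d b P) (\<lambda>_. 0) ((\<Sum>i<k * (n - 1). step_time (lowbit (Suc i)) + 1) + 6)
    (\<lambda>m. stored_at m 0 (lws_T w (replicate k n)))"
proof -
  note K1 = K_large(1)
  let ?L = "k * (n - 1)"
  let ?g = "Op Less (var 0) (Op Add (Op Mul (Const (int k)) (Op Sub size_expr (Const 1))) (Const 1))"
  let ?M = "(\<lambda>_. 0)(cell 4 0 := 1, cell 5 0 := 1) :: memory"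
  have L: "int ?L = int k * (int n - 1)" using n_pos by (simp add: of_nat_diff)
  have LK: "int ?L \<le> K"
  proof -
    have "int ?L \<le> int (k * n)" by (simp only: of_nat_le_iff) simp
    then show ?thesis using k_n_le_K by linarith
  qed
  have loop': "runs W inp (While ?g (static_step k d b P)) ?M
      ((\<Sum>i<?L. step_time (lowbit (Suc i)) + 1) + 1) (main_inv ?L)"
  proof (rule runs_While[where I = main_inv])
    show "main_inv 0 ?M" by (rule main_inv_initial)
    have guard: "ev M ?g = Some (of_bool (i < ?L))" if inv: "main_inv i M" for i M
    proof -
      have M: "all_fit W M" "M (cell 5 0) = int (Suc i)" using inv by (auto simp: main_inv_def)
      have "ev M ?g = Some (of_bool (M (cell 5 0) < int k * (int n - 1) + 1))"
      proof (intro ev_test eval_arith ev_const ev_var ev_size M(1))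
        show "fits W (int k * (int n - 1))" "fits W (int k * (int n - 1) + 1)" "fits W (int n - 1)"
          using LK n_pos n_le_K K1 unfolding L[symmetric] by (auto intro!: fits_small simp del: of_nat_mult)
      qed (use K1 k_le_K in auto)
      moreover have "int (Suc i) < int ?L + 1 \<longleftrightarrow> i < ?L"
      proof -
        have "int ?L + 1 = int (Suc ?L)" by simp
        then show ?thesis by (simp only: of_nat_less_iff) simp
      qed
      ultimately show ?thesis by (simp only: M(2) L[symmetric])
    qed
    show "ev M ?g = Some 0" if "main_inv ?L M" for M using guard[OF that] by simp
    show "(\<exists>z. ev M ?g = Some z \<and> z \<noteq> 0) \<and>
        runs W inp (static_step k d b P) M (step_time (lowbit (Suc i))) (main_inv (Suc i))"
      if "i < ?L" "main_inv i M" for i M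
      using guard[OF that(2)] that runs_static_step by simp
  qed
  have final: "runs W inp (Seq (Store (Const (cell 5 4)) (Op Sub (power_expr k) (Const 1)))
     (Seq (Store (Const 0) (Const 0)) (Store (Const 1) (Load (table_address k d b))))) M (1 + (1 + 1))
     (\<lambda>m. stored_at m 0 (lws_T w (replicate k n)))" if inv: "main_inv ?L M" for M
  proof -
    let ?x = "n ^ k - 1"
    have x_less: "?x < n ^ k" using n_pos by simp
    have x: "int ?x = int n ^ k - 1" using n_pos by (simp add: of_nat_diff)
    have corner: "replicate k n \<in> cube n k" using n_pos by (auto simp: cube_def)
    have "tuple n k ?x = replicate k n"
      using tuple_table_index[OF corner] table_index_corner[OF n_pos] by simp
    \<comment> \<open>The corner lies on the last diagonal, \<open>k + ?L\<close>.\<close>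
    moreover have "partial_T n w k ?L (replicate k n) = lws_T w (replicate k n)"
    proof (rule partial_T_complete[OF w_int corner])
      have "k * (n - 1) + k = k * n" using n_pos by (cases n) auto
      then show "sum_list (replicate k n) \<le> k + ?L" by (simp add: sum_list_replicate)
    qed
    ultimately have res: "M (cell 3 (slot ?x)) = enc_num (lws_T w (replicate k n))"
      using inv x_less by (auto simp: main_inv_def holds_table_def)
    obtain z where z: "lws_T w (replicate k n) = ereal (of_int z)"
      using lws_T_int[where w = w and n = n and k = k] w_int corner by blast
    define M1 where "M1 = M(cell 5 4 := int n ^ k - 1)"
    define M2 where "M2 = M1(cell 0 0 := 0)"
    have pow: "int n ^ k \<le> K" "1 \<le> int n ^ k" using power_le_K[of k] n_pos by auto
    have M: "all_fit W M" using inv by (simp add: main_inv_def)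
    have M1: "all_fit W M1" unfolding M1_def using pow K1 by (intro all_fit_update M fits_small) auto
    have M2: "all_fit W M2" unfolding M2_def using K1 by (intro all_fit_update M1 fits_small) auto
    \<comment> \<open>Output address 0 belongs to array 0, so variable 4 and the table survive this
      store.\<close>
    have M2_eq: "M2 = M1(0 := 0)" by (simp add: M2_def cell_def)
    have M2': "M2 (cell 5 4) = int ?x" "M2 (cell 3 (slot ?x)) = enc_num (lws_T w (replicate k n))"
      unfolding M2_def M1_def using res x by (simp_all add: cell_eq_iff)
    have e1: "ev M (Op Sub (power_expr k) (Const 1)) = Some (int n ^ k - 1)"
      using pow K1 by (intro eval_arith ev_power ev_const fits_small) auto
    have e3: "ev M2 (Load (table_address k d b)) =
        Some (M2 (cell 3 (base + (2 * M2 (cell 5 4) + 1))))"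
      unfolding table_address_def using pow K1 base_bounds x
      by (intro eval_Load ev_at_cell eval_arith ev_table_base ev_const ev_var M2 fits_small) (auto simp: M2')
    have c: "ev M1 (Const 0) = Some 0" "ev M2 (Const 1) = Some 1" "ev M (Const (cell 5 4)) = Some (cell 5 4)"
      using K1 by (intro ev_const ev_const_cell; simp)+
    have post: "stored_at (M2(1 := M2 (cell 3 (base + (2 * M2 (cell 5 4) + 1))))) 0
        (lws_T w (replicate k n))"
      using M2' by (simp add: stored_at_def slot_def z enc_flag_def M2_eq)
    show ?thesis
      by (rule runs_Store_Seq[OF c(3) e1 M1_def], rule runs_Store_Seq[OF c(1) c(1) M2_eq],
          rule runs_Store[OF c(2) e3], rule post)
  qed
  have loop: "runs W inp (Seq (While ?g (static_step k d b P))
     (Seq (Store (Const (cell 5 4)) (Op Sub (power_expr k) (Const 1)))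
     (Seq (Store (Const 0) (Const 0)) (Store (Const 1) (Load (table_address k d b)))))) ?M
     (((\<Sum>i<?L. step_time (lowbit (Suc i)) + 1) + 1) + (1 + (1 + 1)))
     (\<lambda>m. stored_at m 0 (lws_T w (replicate k n)))"
    by (rule runs_Seq, rule runs_mono[OF loop' order_refl final])
  have c: "ev M (Const 1) = Some 1" "ev M (Const (cell 4 0)) = Some (cell 4 0)"
    "ev M (Const (cell 5 0)) = Some (cell 5 0)" for M
    using K1 by (intro ev_const ev_const_cell; simp)+
  have "runs W inp (lws_prog k d b P) (\<lambda>_. 0)
      (1 + (1 + (((\<Sum>i<?L. step_time (lowbit (Suc i)) + 1) + 1) + (1 + (1 + 1)))))
      (\<lambda>m. stored_at m 0 (lws_T w (replicate k n)))"
    unfolding lws_prog_def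
    by (rule runs_Store_Seq[OF c(2) c(1) refl], rule runs_Store_Seq[OF c(3) c(1) refl loop])
  then show ?thesis by (rule runs_mono) auto
qed

end


section \<open>Running time\<close>

definition bit_length :: "nat \<Rightarrow> nat" where
  "bit_length n = nat \<lceil>log 2 (real n + 1)\<rceil>"

lemma bit_length:
  assumes "n \<ge> 1"
  shows "n < 2 ^ bit_length n" "1 \<le> bit_length n" "real (bit_length n) \<le> log 2 n + 2"
proof -
  have "log 2 (real n + 1) \<le> real (bit_length n)"
    unfolding bit_length_def by (rule real_nat_ceiling_ge)
  then have "real n + 1 \<le> 2 powr real (bit_length n)" using assms by (subst log_le_iff[symmetric]) auto
  then have "real (n + 1) \<le> real (2 ^ bit_length n)" by (simp add: powr_realpow)
  then show less: "n < 2 ^ bit_length n" by (simp only: of_nat_le_iff)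
  show "1 \<le> bit_length n" using less assms by (cases "bit_length n") auto
  have "log 2 (real n + 1) \<le> log 2 (2 * real n)" using assms by (subst log_le_cancel_iff) auto
  also have "\<dots> = log 2 n + 1" using assms by (subst log_mult) auto
  finally have "log 2 (real n + 1) \<le> log 2 n + 1" .
  moreover have "0 \<le> log 2 (real n + 1)" by simp
  ultimately show "real (bit_length n) \<le> log 2 n + 2" unfolding bit_length_def by linarith
qed

text \<open>A logarithm is below every positive power, by \<open>ln x \<le> x powr a / a\<close>;
  the numerator of \<open>2 / a\<close> reflects \<open>ln 2 \<ge> 1 / 2\<close>.\<close>

lemma bit_length_powr:
  assumes "n \<ge> 1" "a > 0"
  shows "real (bit_length n) \<le> (2 + 2 / a) * real n powr a"
proof -
  have "ln (real n) \<le> real n powr a / a" using assms by (intro ln_powr_bound) auto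
  moreover have "log 2 (real n) \<le> 2 * ln (real n)"
  proof -
    have "1 / 2 \<le> ln (2::real)" using exp_half_le2 by (subst ln_ge_iff) auto
    then have "ln (real n) * 1 \<le> ln (real n) * (2 * ln 2)" using assms by (intro mult_left_mono) auto
    then show ?thesis by (simp add: log_def field_simps)
  qed
  moreover have "1 \<le> real n powr a" using assms by (intro ge_one_powr_ge_zero) auto
  moreover have "(2 + 2 / a) * real n powr a = 2 * real n powr a + 2 * (real n powr a / a)"
    by (simp add: algebra_simps)
  ultimately show ?thesis using bit_length(3)[OF assms(1)] by linarith
qed

text \<open>Each \<open>N powr p\<close> splits into \<open>N\<close> and
  \<open>N powr (p - 1)\<close>. The second factor is at most \<open>(k * n) powr (p - 1)\<close>
  because \<open>p \<ge> 1\<close>, and the first factors have a nearly linear sum.\<close>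

lemma sum_lowbit_time:
  fixes p :: real and k n :: nat
  assumes "1 \<le> p" "p \<le> 2" "n \<ge> 1" "k \<ge> 1"
  shows "(\<Sum>i<k * (n - 1). real (lowbit (Suc i)) powr p) \<le>
    real k powr p * real n powr p * (real k + real (bit_length n))"
proof -
  let ?L = "k * (n - 1)"
  have "real (lowbit (Suc i)) powr p \<le> real (lowbit (Suc i)) * (real k * real n) powr (p - 1)"
    if "i < ?L" for i
  proof -
    have "lowbit (Suc i) \<le> k * n"
      using lowbit_le[of "Suc i"] that mult_le_mono2[of "n - 1" n k] by linarith
    then have "real (lowbit (Suc i)) \<le> real k * real n" by (metis of_nat_le_iff of_nat_mult)
    then have "real (lowbit (Suc i)) powr (p - 1) \<le> (real k * real n) powr (p - 1)"
      using assms(1) by (intro powr_mono2) auto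
    then have "real (lowbit (Suc i)) * real (lowbit (Suc i)) powr (p - 1) \<le>
        real (lowbit (Suc i)) * (real k * real n) powr (p - 1)"
      by (intro mult_left_mono) auto
    moreover have "real (lowbit (Suc i)) * real (lowbit (Suc i)) powr (p - 1) = real (lowbit (Suc i)) powr p"
      using lowbit_pos[of "Suc i"] by (simp add: powr_mult_base)
    ultimately show ?thesis by simp
  qed
  then have "(\<Sum>i<?L. real (lowbit (Suc i)) powr p) \<le>
      (\<Sum>i<?L. real (lowbit (Suc i)) * (real k * real n) powr (p - 1))"
    by (intro sum_mono) auto
  also have "\<dots> = real (\<Sum>i<?L. lowbit (Suc i)) * (real k * real n) powr (p - 1)"
    by (simp add: sum_distrib_right)
  also have "(\<Sum>i<?L. lowbit (Suc i)) = (\<Sum>t\<in>{1..?L}. lowbit t)"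
    by (rule sum.reindex_bij_witness[of _ "\<lambda>t. t - 1" Suc]) auto
  also have "real (\<Sum>t\<in>{1..?L}. lowbit t) * (real k * real n) powr (p - 1) \<le>
      real (k * n * (k + bit_length n)) * (real k * real n) powr (p - 1)"
  proof (intro mult_right_mono)
    have "?L \<le> k * n" by simp
    \<comment> \<open>This makes \<open>k + bit_length n\<close> the number of levels in
      \<open>sum_lowbit_le\<close>.\<close>
    also have "k * n < 2 ^ k * 2 ^ bit_length n"
      using bit_length(1)[OF assms(3)] assms by (intro mult_strict_mono) auto
    finally have "(\<Sum>t\<in>{1..?L}. lowbit t) \<le> ?L * (k + bit_length n)"
      by (intro sum_lowbit_le) (simp add: power_add)
    also have "\<dots> \<le> k * n * (k + bit_length n)" by (intro mult_right_mono) auto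
    finally show "real (\<Sum>t\<in>{1..?L}. lowbit t) \<le> real (k * n * (k + bit_length n))"
      by (simp only: of_nat_le_iff)
  qed simp
  also have "\<dots> = (real k * real n) * (real k * real n) powr (p - 1) * (real k + real (bit_length n))"
    by (simp add: algebra_simps)
  also have "(real k * real n) * (real k * real n) powr (p - 1) = (real k * real n) powr p"
    using assms by (simp add: powr_mult_base)
  also have "\<dots> = real k powr p * real n powr p" by (simp add: powr_mult)
  finally show ?thesis .
qed

section \<open>From encoded instances to the assumptions of the reduction\<close>

lemma lws_instance_int:
  assumes "lws_instance k d c b dec n w e" "l < k" "is \<in> cube n (k + 1)"
  shows "\<exists>z. w l is = ereal (of_int z)"
proof -
  have "w l is \<noteq> \<infinity>" using assms by (auto simp: lws_instance_def rank_by_def)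
  moreover from assms obtain B where "w l is = \<infinity> \<or> (\<exists>z\<in>{-B..B}. w l is = ereal (real_of_int z))"
    unfolding lws_instance_def by blast
  ultimately show ?thesis by blast
qed

lemma all_fit_lws_input:
  assumes inst: "lws_instance k d c b dec n w e" and input: "lws_input k d b n e inp"
    and W: "word_size c n \<le> W" "bit_length n \<le> W"
  shows "all_fit W inp"
  unfolding all_fit_def
proof
  fix p
  have n: "n \<ge> 1" using inst by (simp add: lws_instance_def)
  consider "p = 0" | "p < 0 \<or> p \<ge> int (1 + vec_words k d b n)" | x where "p = int (1 + x)" "x < vec_words k d b n"
  proof -
    have "p = 0 \<or> (p < 0 \<or> p \<ge> int (1 + vec_words k d b n)) \<or> (p = int (1 + nat (p - 1)) \<and> nat (p - 1) < vec_words k d b n)"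
      by linarith
    then show ?thesis using that by blast
  qed
  then show "fits W (inp p)"
  proof cases
    case 1
    have "fits (bit_length n) (int n)" using bit_length(1)[OF n] by (intro fitsI) simp
    then show ?thesis using 1 input fits_mono[OF _ W(2)] by (simp add: lws_input_def)
  next
    case 2
    then show ?thesis using input fits_zero by (auto simp: lws_input_def)
  next
    case (3 x)
    then have pos: "0 < vec_words k d b n" by simp
    then have dims: "0 < k" "0 < n" "0 < d" "0 < b" by (auto simp: vec_words_def)
    \<comment> \<open>Successive quotients and remainders recover the indices of the vector word
      stored at a given address.\<close>
    define y where "y = x div b div d"
    have y: "y < k * (k + 1) * n"
      using 3(2) by (simp add: y_def vec_words_def less_mult_imp_div_less mult.commute mult.left_commute)
    have "y div n < k * (k + 1)" using y by (simp add: less_mult_imp_div_less)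
    then have "y div n div (k + 1) < k" by (simp only: less_mult_imp_div_less)
    moreover have "y div n mod (k + 1) < k + 1" "y mod n + 1 \<in> {1..n}" "x div b mod d < d" "x mod b < b"
      using dims by (auto simp: Suc_le_eq)
    moreover have "(((y div n div (k + 1) * (k + 1) + y div n mod (k + 1)) * n + (y mod n + 1 - 1)) * d +
        x div b mod d) * b + x mod b = x"
      by (simp only: div_mult_mod_eq add_diff_cancel_right' y_def)
    ultimately have "inp (int (1 + x)) = e (y div n div (k + 1)) (y div n mod (k + 1)) (y mod n + 1) (x div b mod d) (x mod b)"
      "fits (word_size c n) (e (y div n div (k + 1)) (y div n mod (k + 1)) (y mod n + 1) (x div b mod d) (x mod b))"
      using input inst unfolding lws_input_def vectors_at_def lws_instance_def by metis+
    then show ?thesis using 3(1) fits_mono[OF _ W(1)] by simp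
  qed
qed

theorem theorem3p2:
  fixes k d c b :: nat and dec :: "int list \<Rightarrow> real"
  assumes "k \<ge> 1" and "d \<ge> 1"
    and "\<exists>\<epsilon>>0. static_lws_algorithm k d c b dec (\<lambda>n N. real N powr (2 - \<epsilon>) * real n ^ (k - 1))"
  shows "\<exists>\<delta>>0. lws_algorithm k d c b dec (\<lambda>n. real n powr (real k + 1 - \<delta>))"
proof -
  from assms(3) obtain \<epsilon> P c' C where "\<epsilon> > 0" and static: "\<And>n w e a N inp.
        lws_instance k d c b dec n w e \<and>
        N \<ge> 1 \<and> int k \<le> a \<and> a + int N \<le> int (k * n) \<and>
        static_input k d b n w e a N inp \<Longrightarrow>
        \<exists>t m. exec (word_size c' n) inp P (\<lambda>_. 0) t m \<and>
           real t \<le> C * (real N powr (2 - \<epsilon>) * real n ^ (k - 1)) \<and>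
           (\<forall>js\<in>strip n k (a + int N) (a + 2 * int N).
              stored_at m (2 * table_index n js) (static_T n w a N js))"
    unfolding static_lws_algorithm_def by metis
  \<comment> \<open>The calls save a factor \<open>n powr (2 * \<delta>)\<close>, of which
    \<open>n powr \<delta>\<close> pays for the logarithm.\<close>
  define \<delta> where "\<delta> = min \<epsilon> 1 / 2"
  have \<delta>: "0 < \<delta>" "2 * \<delta> \<le> 1" "2 * \<delta> \<le> \<epsilon>" using \<open>\<epsilon> > 0\<close> by (auto simp: \<delta>_def)
  define p where "p = 2 - 2 * \<delta>"
  have p: "1 \<le> p" "p \<le> 2" "2 - \<epsilon> \<le> p" using \<delta> by (auto simp: p_def)
  define A where "A = k * (k + 1) * d * b"
  \<comment> \<open>In this exponent \<open>c'\<close> accounts for the words of the static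
    algorithm, \<open>c\<close> for those of the instance, \<open>2 * k\<close> for
    \<open>k * n ^ k\<close>, \<open>A\<close> and 1 more for the vectors, and 4 for the lower bound
    16 on \<open>K\<close>.\<close>
  define q where "q = c' + c + 2 * k + A + 4"
  \<comment> \<open>\<open>C\<close> may be negative, hence the maximum. The 15 collects the two
    constants 7 of \<open>step_time\<close> and the test of the main loop.\<close>
  define D where "D = 3 * max C 0 + 15"
  define F where "F = D * (real k powr p * (real k + (2 + 2 / \<delta>))) + 6"
  have D: "0 \<le> D" by (simp add: D_def)
  have "\<exists>t m. exec (word_size (q + 10) n) inp (lws_prog k d b P) (\<lambda>_. 0) t m \<and>
      real t \<le> F * real n powr (real k + 1 - \<delta>) \<and> stored_at m 0 (lws_T w (replicate k n))"
    if inst: "lws_instance k d c b dec n w e" and input: "lws_input k d b n e inp" for n w e inp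
  proof -
    let ?l = "bit_length n"
    define K :: int where "K = 2 ^ (q * ?l)"
    have n: "n \<ge> 1" using inst by (simp add: lws_instance_def)
    note l = bit_length[OF n]
    have word_size: "word_size x n = x * ?l" for x by (simp add: word_size_def bit_length_def)
    have K_mono: "2 ^ x \<le> K" if "x \<le> q * ?l" for x
      unfolding K_def using that by (intro power_increasing) auto
    have le_mult: "x \<le> x * ?l" for x using l(2) by simp
    have pow_le: "int x \<le> 2 ^ x" for x
      using of_nat_less_two_power[of x, where 'a = int] by simp
    have n_le: "int n \<le> 2 ^ ?l"
      using l(1) by (metis less_imp_le of_nat_le_iff of_nat_numeral of_nat_power)
    interpret static_reduction k d b n "word_size c' n" "word_size (q + 10) n" w e inp K P
      "\<lambda>N. C * (real N powr (2 - \<epsilon>) * real n ^ (k - 1))"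
    proof
      show "\<exists>z. w l is = ereal (of_int z)" if "l < k" "is \<in> cube n (k + 1)" for l "is"
        by (rule lws_instance_int[OF inst that])
      show "all_fit (word_size (q + 10) n) inp"
        by (rule all_fit_lws_input[OF inst input]) (auto simp: word_size q_def)
      have "4 \<le> q * ?l" using le_mult[of q] unfolding q_def by linarith
      from K_mono[OF this] show "16 \<le> K" by simp
      have "int k * int n ^ k \<le> 2 ^ k * (2 ^ ?l) ^ k"
        by (intro mult_mono power_mono pow_le n_le) auto
      also have "\<dots> = 2 ^ (k + ?l * k)" by (simp add: power_add power_mult)
      also have "\<dots> \<le> K"
      proof (intro K_mono)
        have "k + ?l * k \<le> (2 * k) * ?l" using le_mult[of k] by (simp add: mult.commute)
        also have "\<dots> \<le> q * ?l" by (intro mult_right_mono) (auto simp: q_def)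
        finally show "k + ?l * k \<le> q * ?l" .
      qed
      finally show "int k * int n ^ k \<le> K" .
      have A_le: "A * ?l + ?l \<le> q * ?l"
      proof -
        have "A * ?l + ?l = (A + 1) * ?l" by simp
        also have "\<dots> \<le> q * ?l" by (intro mult_right_mono) (auto simp: q_def)
        finally show ?thesis .
      qed
      have "int A \<le> 2 ^ A" by (rule pow_le)
      also have "\<dots> \<le> K" using A_le le_mult[of A] by (intro K_mono) linarith
      finally show "int (k * (k + 1) * d * b) \<le> K" by (simp only: A_def)
      have "int A * int n \<le> 2 ^ A * 2 ^ ?l" by (intro mult_mono pow_le n_le) auto
      also have "\<dots> = 2 ^ (A + ?l)" by (simp add: power_add)
      also have "\<dots> \<le> K" using A_le le_mult[of A] by (intro K_mono) linarith
      finally show "int (vec_words k d b n) \<le> K" by (simp add: A_def vec_words_def mult_ac)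
      show "2 ^ word_size c' n \<le> K"
        unfolding word_size by (intro K_mono mult_right_mono) (auto simp: q_def)
      \<comment> \<open>This is why the word size has the coefficient \<open>q + 10\<close>.\<close>
      have "1000 * K \<le> 2 ^ 10 * K" by (simp add: K_def)
      also have "\<dots> \<le> 2 ^ (10 * ?l) * K"
        using l(2) by (intro mult_right_mono power_increasing) (auto simp: K_def)
      also have "\<dots> = 2 ^ word_size (q + 10) n" by (simp add: K_def word_size add_mult_distrib power_add)
      finally show "1000 * K \<le> 2 ^ word_size (q + 10) n" .
    qed (use assms(1) n input static inst in \<open>auto simp del: of_nat_mult\<close>)
    have step: "step_time (lowbit (Suc i)) + 1 \<le> D * (real (lowbit (Suc i)) powr p * real n ^ (k - 1))" for i
    proof -
      let ?N = "real (lowbit (Suc i))" and ?m = "real n ^ (k - 1)"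
      have N: "1 \<le> ?N" using lowbit_pos[of "Suc i"] by simp
      have m: "1 \<le> ?m" using n by simp
      have "C * (?N powr (2 - \<epsilon>) * ?m) \<le> max C 0 * (?N powr p * ?m)"
        using N p m by (intro mult_mono powr_mono) auto
      moreover have "?N * ?m \<le> ?N powr p * ?m"
        using N m p(1) powr_mono[of 1 p ?N] by (intro mult_right_mono) auto
      moreover have "1 * 1 \<le> ?N powr p * ?m"
        using N m p by (intro mult_mono ge_one_powr_ge_zero) auto
      ultimately show ?thesis unfolding step_time_def D_def by (simp add: algebra_simps)
    qed
    have one: "1 \<le> real n powr (real k + 1 - \<delta>)"
      using n \<delta> assms(1) by (intro ge_one_powr_ge_zero) auto
    have "(\<Sum>i<k * (n - 1). step_time (lowbit (Suc i)) + 1) \<le>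
        (\<Sum>i<k * (n - 1). D * (real (lowbit (Suc i)) powr p * real n ^ (k - 1)))"
      by (intro sum_mono step)
    also have "\<dots> = D * (real n ^ (k - 1) * (\<Sum>i<k * (n - 1). real (lowbit (Suc i)) powr p))"
      by (simp add: sum_distrib_left sum_distrib_right mult_ac)
    also have "\<dots> \<le> D * (real n ^ (k - 1) *
        (real k powr p * real n powr p * (real k + real ?l)))"
      using sum_lowbit_time[OF p(1,2) n assms(1)] D by (intro mult_left_mono) auto
    also have "real k + real ?l \<le> (real k + (2 + 2 / \<delta>)) * real n powr \<delta>"
    proof -
      have "real k * 1 \<le> real k * real n powr \<delta>"
        using n \<delta> by (intro mult_left_mono ge_one_powr_ge_zero) auto
      then show ?thesis using bit_length_powr[OF n \<delta>(1)] by (simp only: distrib_right)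
    qed
    also have "D * (real n ^ (k - 1) * (real k powr p * real n powr p *
        ((real k + (2 + 2 / \<delta>)) * real n powr \<delta>))) =
        D * (real k powr p * (real k + (2 + 2 / \<delta>))) * (real n ^ (k - 1) * real n powr p * real n powr \<delta>)"
      by (simp only: mult_ac)
    also have "real n ^ (k - 1) * real n powr p * real n powr \<delta> = real n powr (real k + 1 - \<delta>)"
    proof -
      have "real n ^ (k - 1) = real n powr (real k - 1)"
        using n assms(1) by (simp add: powr_realpow[symmetric] of_nat_diff)
      then have "real n ^ (k - 1) * real n powr p * real n powr \<delta> = real n powr (real k - 1 + p + \<delta>)"
        by (simp only: powr_add)
      also have "real k - 1 + p + \<delta> = real k + 1 - \<delta>" by (simp add: p_def)
      finally show ?thesis .
    qed
    finally have "(\<Sum>i<k * (n - 1). step_time (lowbit (Suc i)) + 1) \<le>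
        D * (real k powr p * (real k + (2 + 2 / \<delta>))) * real n powr (real k + 1 - \<delta>)"
      using D \<delta> by (auto simp: mult_left_mono)
    then have "(\<Sum>i<k * (n - 1). step_time (lowbit (Suc i)) + 1) + 6 \<le> F * real n powr (real k + 1 - \<delta>)"
      using one unfolding F_def distrib_right by linarith
    then show ?thesis
      using runs_lws_prog unfolding runs_def by (meson order_trans)
  qed
  then have "lws_algorithm k d c b dec (\<lambda>n. real n powr (real k + 1 - \<delta>))"
    unfolding lws_algorithm_def by blast
  then show ?thesis using \<delta>(1) by blast
qed

end
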